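(* Let $(\phi_t)_{t\ge0}$ be a semigroup of holomorphic self-maps of $\mathbb{D}$ that is not a group, and let $\Delta$ be a petal of $(\phi_t)$. For $z\in\Delta$ and the geodesic $\eta$ associated with $z$ and $\Delta$, let $v^o_\Delta(t)=d_{\mathbb{D}}(z,\pi_\eta(\phi_t(z)))$ and $v^T_\Delta(t)=d_{\mathbb{D}}(\phi_t(z),\eta)$, $t\le0$, be the orthogonal and tangential speeds of $\Delta$. The following are true. (i) If $\Delta$ is hyperbolic with repelling spectral value $\lambda\in(-\infty,0)$, then $$\lim_{t\to-\infty}\frac{v^o_\Delta(t)}{t}=\frac{\lambda}{2}\quad\text{and}\quad\lim_{t\to-\infty}\frac{v^T_\Delta(t)}{t}=0.$$ (ii) If $\Delta$ is parabolic, then $$\lim_{t\to-\infty}\frac{v^o_\Delta(t)}{t}=\lim_{t\to-\infty}\frac{v^T_\Delta(t)}{t}=0.$$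
   Context: $\mathbb{D}$ is the unit disk, and $d_{\mathbb{D}}(z,w)=\operatorname{arctanh}\left|\frac{z-w}{1-\bar z w}\right|$ is its hyperbolic distance. A semigroup in $\mathbb{D}$ is a family $(\phi_t)_{t\ge0}$ of holomorphic self-maps of $\mathbb{D}$ with $\phi_0=\mathrm{id}$, $\phi_{t+s}=\phi_t\circ\phi_s$ for all $t,s\ge0$, and $\phi_t(z)\to z$ uniformly on compacta as $t\to0^+$. It is a group if some (equivalently every) $\phi_{t_0}$, $t_0>0$, is an automorphism of $\mathbb{D}$. If it is not a group, there is a unique $\tau\in\overline{\mathbb{D}}$ (the Denjoy--Wolff point) with $\phi_t(z)\to\tau$ as $t\to+\infty$ for all $z\in\mathbb{D}$; the semigroup is elliptic if $\tau\in\mathbb{D}$ and non-elliptic if $\tau\in\partial\mathbb{D}$. A boundary fixed point is a point $\sigma\in\partial\mathbb{D}$ with $\angle\lim_{z\to\sigma}\phi_t(z)=\sigma$ for all $t\ge0$; it is regular if the angular derivative $\phi_t'(\sigma)$ is finite for all $t\ge0$. A repelling fixed point is a regular boundary fixed point different from $\tau$; its repelling spectral value is the $\lambda\in(-\infty,0)$ with $\phi_t'(\sigma)=e^{-\lambda t}$ for all $t\ge0$. The backward invariant set is $\mathcal{W}=\bigcap_{t\ge0}\phi_t(\mathbb{D})$. A petal is a non-empty connected component $\Delta$ of the interior of $\mathcal{W}$. Each $\phi_t$ ($t\ge 0$) restricts to an automorphism of $\Delta$; for $z\in\Delta$ and $t\le0$ one writes $\phi_t(z):=(\phi_{-t}|_\Delta)^{-1}(z)$.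 The curve $t\mapsto\phi_t(z)$, $t\le0$, is the backward orbit of $z$. A non-elliptic semigroup has a unique Koenigs function: a univalent holomorphic $h:\mathbb{D}\to\mathbb{C}$ with $h(0)=0$ and $h(\phi_t(z))=h(z)+t$ for all $z\in\mathbb D$, $t\ge0$. A petal $\Delta$ of a non-elliptic semigroup is hyperbolic if $h(\Delta)$ is a maximal horizontal strip in $h(\mathbb{D})$, and parabolic if $h(\Delta)$ is a maximal horizontal half-plane in $h(\mathbb{D})$ (one of the two always holds). Every petal of an elliptic semigroup is called hyperbolic. All backward orbits in a hyperbolic petal converge, as $t\to-\infty$, to one and the same repelling fixed point $\sigma$, and the repelling spectral value of the petal is that of $\sigma$; all backward orbits in a parabolic petal converge to $\tau$. Given $z\in\Delta$, $\eta:(-1,1)\to\mathbb{D}$ denotes the (full) geodesic of $d_{\mathbb{D}}$ with $\eta(0)=z$ and $\lim_{r\to1^-}\eta(r)=\sigma$ if $\Delta$ is hyperbolic, respectively $\lim_{r\to1^-}\eta(r)=\tau$ if $\Delta$ is parabolic. For $w\in\mathbb{D}$, $d_{\mathbb{D}}(w,\eta):=\inf_{r\in(-1,1)}d_{\mathbb{D}}(w,\eta(r))$, and the projection $\pi_\eta(w)$ is the point of $\eta$ with $d_{\mathbb{D}}(w,\pi_\eta(w))=d_{\mathbb{D}}(w,\eta)$. *)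

theory Defs
  imports "HOL-Complex_Analysis.Complex_Analysis"
begin

abbreviation unit_disk :: "complex set" where
  "unit_disk \<equiv> ball 0 1"

definition hyp_dist :: "complex \<Rightarrow> complex \<Rightarrow> real" where
  "hyp_dist z w = artanh (cmod ((z - w) / (1 - cnj z * w)))"


subsection \<open>Semigroups of holomorphic self-maps of the disk\<close>

text \<open>A semigroup is a function \<open>\<phi>\<close> of which only the values \<open>\<phi> t z\<close> with \<open>t \<ge> 0\<close>
  and \<open>z\<close> in the disk are meaningful.\<close>

definition disk_semigroup :: "(real \<Rightarrow> complex \<Rightarrow> complex) \<Rightarrow> bool" where
  "disk_semigroup \<phi> \<longleftrightarrow>
     (\<forall>t\<ge>0. \<phi> t holomorphic_on unit_disk \<and> \<phi> t ` unit_disk \<subseteq> unit_disk) \<and>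
     (\<forall>z\<in>unit_disk. \<phi> 0 z = z) \<and>
     (\<forall>t\<ge>0. \<forall>s\<ge>0. \<forall>z\<in>unit_disk. \<phi> (t + s) z = \<phi> t (\<phi> s z)) \<and>
     (\<forall>K. compact K \<and> K \<subseteq> unit_disk \<longrightarrow> uniform_limit K \<phi> (\<lambda>z. z) (at_right 0))"

definition disk_automorphism :: "(complex \<Rightarrow> complex) \<Rightarrow> bool" where
  "disk_automorphism f \<longleftrightarrow>
     f holomorphic_on unit_disk \<and> f ` unit_disk \<subseteq> unit_disk \<and>
     (\<exists>g. g holomorphic_on unit_disk \<and> g ` unit_disk \<subseteq> unit_disk \<and>
          (\<forall>z\<in>unit_disk. g (f z) = z \<and> f (g z) = z))"

definition disk_group :: "(real \<Rightarrow> complex \<Rightarrow> complex) \<Rightarrow> bool" where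
  "disk_group \<phi> \<longleftrightarrow> disk_semigroup \<phi> \<and> (\<exists>t>0. disk_automorphism (\<phi> t))"

definition denjoy_wolff_point :: "(real \<Rightarrow> complex \<Rightarrow> complex) \<Rightarrow> complex \<Rightarrow> bool" where
  "denjoy_wolff_point \<phi> \<tau> \<longleftrightarrow>
     \<tau> \<in> cball 0 1 \<and> (\<forall>z\<in>unit_disk. ((\<lambda>t. \<phi> t z) \<longlongrightarrow> \<tau>) at_top)"

definition elliptic :: "(real \<Rightarrow> complex \<Rightarrow> complex) \<Rightarrow> bool" where
  "elliptic \<phi> \<longleftrightarrow> (\<exists>\<tau>\<in>unit_disk. denjoy_wolff_point \<phi> \<tau>)"

definition non_elliptic :: "(real \<Rightarrow> complex \<Rightarrow> complex) \<Rightarrow> bool" where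
  "non_elliptic \<phi> \<longleftrightarrow> (\<exists>\<tau>\<in>sphere 0 1. denjoy_wolff_point \<phi> \<tau>)"


subsection \<open>Boundary fixed points\<close>

definition stolz_region :: "complex \<Rightarrow> real \<Rightarrow> complex set" where
  "stolz_region \<sigma> M = {z \<in> unit_disk. cmod (\<sigma> - z) < M * (1 - cmod z)}"

definition has_angular_limit :: "(complex \<Rightarrow> complex) \<Rightarrow> complex \<Rightarrow> complex \<Rightarrow> bool" where
  "has_angular_limit f \<sigma> L \<longleftrightarrow> (\<forall>M>1. (f \<longlongrightarrow> L) (at \<sigma> within stolz_region \<sigma> M))"

definition boundary_fixed_point :: "(real \<Rightarrow> complex \<Rightarrow> complex) \<Rightarrow> complex \<Rightarrow> bool" where
  "boundary_fixed_point \<phi> \<sigma> \<longleftrightarrow>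
     \<sigma> \<in> sphere 0 1 \<and> (\<forall>t\<ge>0. has_angular_limit (\<phi> t) \<sigma> \<sigma>)"

text \<open>Angular derivative at a boundary point \<open>\<sigma>\<close> that is fixed by \<open>f\<close>; the predicate says
  that it exists, is finite, and equals \<open>d\<close>.\<close>

definition has_angular_derivative_at_fixed :: "(complex \<Rightarrow> complex) \<Rightarrow> complex \<Rightarrow> complex \<Rightarrow> bool" where
  "has_angular_derivative_at_fixed f \<sigma> d \<longleftrightarrow>
     has_angular_limit (\<lambda>z. (f z - \<sigma>) / (z - \<sigma>)) \<sigma> d"

definition regular_fixed_point :: "(real \<Rightarrow> complex \<Rightarrow> complex) \<Rightarrow> complex \<Rightarrow> bool" where
  "regular_fixed_point \<phi> \<sigma> \<longleftrightarrow>
     boundary_fixed_point \<phi> \<sigma> \<and> (\<forall>t\<ge>0. \<exists>d. has_angular_derivative_at_fixed (\<phi> t) \<sigma> d)"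

definition repelling_fixed_point :: "(real \<Rightarrow> complex \<Rightarrow> complex) \<Rightarrow> complex \<Rightarrow> bool" where
  "repelling_fixed_point \<phi> \<sigma> \<longleftrightarrow> regular_fixed_point \<phi> \<sigma> \<and> \<not> denjoy_wolff_point \<phi> \<sigma>"

definition repelling_spectral_value :: "(real \<Rightarrow> complex \<Rightarrow> complex) \<Rightarrow> complex \<Rightarrow> real \<Rightarrow> bool" where
  "repelling_spectral_value \<phi> \<sigma> lam \<longleftrightarrow>
     repelling_fixed_point \<phi> \<sigma> \<and> lam < 0 \<and>
     (\<forall>t\<ge>0. has_angular_derivative_at_fixed (\<phi> t) \<sigma> (of_real (exp (- lam * t))))"


subsection \<open>Petals\<close>

definition backward_invariant_set :: "(real \<Rightarrow> complex \<Rightarrow> complex) \<Rightarrow> complex set" where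
  "backward_invariant_set \<phi> = (\<Inter>t\<in>{0..}. \<phi> t ` unit_disk)"

definition petal :: "(real \<Rightarrow> complex \<Rightarrow> complex) \<Rightarrow> complex set \<Rightarrow> bool" where
  "petal \<phi> \<Delta> \<longleftrightarrow> \<Delta> \<in> components (interior (backward_invariant_set \<phi>))"

text \<open>The point \<open>\<phi>\<^sub>t(z)\<close> for \<open>t \<le> 0\<close> and \<open>z \<in> \<Delta>\<close>, where \<open>\<Delta>\<close> is a petal.\<close>

definition backward_orbit ::
    "(real \<Rightarrow> complex \<Rightarrow> complex) \<Rightarrow> complex set \<Rightarrow> complex \<Rightarrow> real \<Rightarrow> complex" where
  "backward_orbit \<phi> \<Delta> z t = inv_into \<Delta> (\<phi> (- t)) z"

definition koenigs_function :: "(real \<Rightarrow> complex \<Rightarrow> complex) \<Rightarrow> (complex \<Rightarrow> complex) \<Rightarrow> bool" where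
  "koenigs_function \<phi> h \<longleftrightarrow>
     h holomorphic_on unit_disk \<and> inj_on h unit_disk \<and> h 0 = 0 \<and>
     (\<forall>t\<ge>0. \<forall>z\<in>unit_disk. h (\<phi> t z) = h z + of_real t)"

definition horizontal_strip :: "complex set \<Rightarrow> bool" where
  "horizontal_strip S \<longleftrightarrow> (\<exists>a b. a < b \<and> S = {w. a < Im w \<and> Im w < b})"

definition horizontal_half_plane :: "complex set \<Rightarrow> bool" where
  "horizontal_half_plane S \<longleftrightarrow> (\<exists>a. S = {w. a < Im w} \<or> S = {w. Im w < a})"

definition maximal_in :: "(complex set \<Rightarrow> bool) \<Rightarrow> complex set \<Rightarrow> complex set \<Rightarrow> bool" where
  "maximal_in P S \<Omega> \<longleftrightarrow>
     P S \<and> S \<subseteq> \<Omega> \<and> (\<forall>S'. P S' \<and> S \<subseteq> S' \<and> S' \<subseteq> \<Omega> \<longrightarrow> S' = S)"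

text \<open>The Koenigs function of a non-elliptic semigroup exists and is unique, so the
  existential quantifier over \<open>h\<close> below just names it.\<close>

definition hyperbolic_petal :: "(real \<Rightarrow> complex \<Rightarrow> complex) \<Rightarrow> complex set \<Rightarrow> bool" where
  "hyperbolic_petal \<phi> \<Delta> \<longleftrightarrow> petal \<phi> \<Delta> \<and>
     (elliptic \<phi> \<or>
      non_elliptic \<phi> \<and>
      (\<exists>h. koenigs_function \<phi> h \<and> maximal_in horizontal_strip (h ` \<Delta>) (h ` unit_disk)))"

definition parabolic_petal :: "(real \<Rightarrow> complex \<Rightarrow> complex) \<Rightarrow> complex set \<Rightarrow> bool" where
  "parabolic_petal \<phi> \<Delta> \<longleftrightarrow> petal \<phi> \<Delta> \<and> non_elliptic \<phi> \<and>
     (\<exists>h. koenigs_function \<phi> h \<and> maximal_in horizontal_half_plane (h ` \<Delta>) (h ` unit_disk))"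

text \<open>The repelling fixed point to which all backward orbits in a hyperbolic petal converge.\<close>

definition petal_repelling_point ::
    "(real \<Rightarrow> complex \<Rightarrow> complex) \<Rightarrow> complex set \<Rightarrow> complex \<Rightarrow> bool" where
  "petal_repelling_point \<phi> \<Delta> \<sigma> \<longleftrightarrow> repelling_fixed_point \<phi> \<sigma> \<and>
     (\<forall>z\<in>\<Delta>. (backward_orbit \<phi> \<Delta> z \<longlongrightarrow> \<sigma>) at_bot)"

definition petal_spectral_value ::
    "(real \<Rightarrow> complex \<Rightarrow> complex) \<Rightarrow> complex set \<Rightarrow> real \<Rightarrow> bool" where
  "petal_spectral_value \<phi> \<Delta> lam \<longleftrightarrow>
     (\<exists>\<sigma>. petal_repelling_point \<phi> \<Delta> \<sigma> \<and> repelling_spectral_value \<phi> \<sigma> lam)"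


subsection \<open>Geodesics and projections\<close>

text \<open>The parametrization of a geodesic by \<open>(-1,1)\<close> is arbitrary (not by arc length): a geodesic
  is an injective curve along which \<open>hyp_dist\<close> is additive, and it is full if both of its ends
  have infinite length.\<close>

definition full_geodesic :: "(real \<Rightarrow> complex) \<Rightarrow> bool" where
  "full_geodesic \<eta> \<longleftrightarrow>
     continuous_on {-1<..<1} \<eta> \<and> inj_on \<eta> {-1<..<1} \<and> \<eta> ` {-1<..<1} \<subseteq> unit_disk \<and>
     (\<forall>r s t. -1 < r \<and> r \<le> s \<and> s \<le> t \<and> t < 1 \<longrightarrow>
        hyp_dist (\<eta> r) (\<eta> t) = hyp_dist (\<eta> r) (\<eta> s) + hyp_dist (\<eta> s) (\<eta> t)) \<and>
     filterlim (\<lambda>r. hyp_dist (\<eta> 0) (\<eta> r)) at_top (at_left 1) \<and>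
     filterlim (\<lambda>r. hyp_dist (\<eta> 0) (\<eta> r)) at_top (at_right (-1))"

definition petal_geodesic ::
    "(real \<Rightarrow> complex \<Rightarrow> complex) \<Rightarrow> complex set \<Rightarrow> complex \<Rightarrow> (real \<Rightarrow> complex) \<Rightarrow> bool" where
  "petal_geodesic \<phi> \<Delta> z \<eta> \<longleftrightarrow> full_geodesic \<eta> \<and> \<eta> 0 = z \<and>
     (\<exists>p. (hyperbolic_petal \<phi> \<Delta> \<and> petal_repelling_point \<phi> \<Delta> p \<or>
           parabolic_petal \<phi> \<Delta> \<and> denjoy_wolff_point \<phi> p) \<and>
          (\<eta> \<longlongrightarrow> p) (at_left 1))"

definition dist_to_geodesic :: "complex \<Rightarrow> (real \<Rightarrow> complex) \<Rightarrow> real" where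
  "dist_to_geodesic w \<eta> = (INF r\<in>{-1<..<1}. hyp_dist w (\<eta> r))"

definition geodesic_projection :: "(real \<Rightarrow> complex) \<Rightarrow> complex \<Rightarrow> complex" where
  "geodesic_projection \<eta> w =
     (THE p. p \<in> \<eta> ` {-1<..<1} \<and> hyp_dist w p = dist_to_geodesic w \<eta>)"

definition orthogonal_speed ::
    "(real \<Rightarrow> complex \<Rightarrow> complex) \<Rightarrow> complex set \<Rightarrow> complex \<Rightarrow> (real \<Rightarrow> complex) \<Rightarrow> real \<Rightarrow> real" where
  "orthogonal_speed \<phi> \<Delta> z \<eta> t =
     hyp_dist z (geodesic_projection \<eta> (backward_orbit \<phi> \<Delta> z t))"

definition tangential_speed ::
    "(real \<Rightarrow> complex \<Rightarrow> complex) \<Rightarrow> complex set \<Rightarrow> complex \<Rightarrow> (real \<Rightarrow> complex) \<Rightarrow> real \<Rightarrow> real" where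
  "tangential_speed \<phi> \<Delta> z \<eta> t = dist_to_geodesic (backward_orbit \<phi> \<Delta> z t) \<eta>"

end

theory Submission
  imports Defs "HOL-Real_Asymp.Real_Asymp"
begin


text \<open>
  Write \<open>w s\<close> for the point \<open>\<phi>\<^sub>-\<^sub>s(z)\<close> of the backward orbit and \<open>D s\<close> for its hyperbolic
  distance from \<open>z\<close>, as \<open>s \<rightarrow> \<infinity>\<close>. As \<open>z\<close> lies on the geodesic, the tangential speed is at most
  \<open>D s\<close>, and by the triangle inequality the orthogonal speed differs from \<open>D s\<close> by at most the
  tangential speed (\<open>speeds_triangle\<close>). So it suffices to find the rate of \<open>D\<close> and, in the
  hyperbolic case, to bound the tangential speed.

  \<^bold>\<open>Parabolic petals.\<close> The Koenigs function maps the petal onto a half-plane and turns \<open>w s\<close> into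
  a horizontal translate by \<open>- s\<close>. Two points of a half-plane at the same height and horizontal
  distance \<open>s\<close> have hyperbolic distance \<open>O(ln s)\<close>, and the inverse Koenigs function contracts
  hyperbolic distances. Hence \<open>D s / s \<rightarrow> 0\<close>.

  \<^bold>\<open>Hyperbolic petals.\<close> Let \<open>\<alpha> = - \<lambda>\<close> and let \<open>\<sigma>\<close> be the repelling fixed point. On a small disk around
  \<open>z\<close> the inverse of every \<open>\<phi>\<^sub>s\<close> is defined, so by Schwarz--Pick there is a \<open>\<delta> > 0\<close> such that
  orbit points at most \<open>\<delta>\<close> apart in time have hyperbolic distance below a fixed constant
  (\<open>backward_orbit_bounded_steps\<close>). Julia's lemma for \<open>\<phi>\<^sub>\<delta>\<close> at \<open>\<sigma>\<close>, where the angular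
  derivative is \<open>exp(\<alpha>\<delta>) > 1\<close>, shows that \<open>1 - |w s|\<close> decays geometrically
  (\<open>boundary_dilation_ge_angular_derivative\<close>). Each step has Euclidean length at most a
  constant times \<open>1 - |w s|\<close>, so summing a geometric series gives \<open>|w s - \<sigma>| \<le> K (1 - |w s|)\<close>: the
  orbit tends to \<open>\<sigma>\<close> nontangentially. This has two consequences. The distance from the orbit to the
  geodesic, which also ends at \<open>\<sigma>\<close>, is bounded. And the angular derivative now governs the orbit:
  the quotient of \<open>w s - \<sigma>\<close> by \<open>w (s + \<delta>) - \<sigma>\<close> tends to \<open>exp(\<alpha>\<delta>)\<close>, so
  \<open>- ln |w s - \<sigma>|\<close>, which is \<open>2 D s\<close> up to a bounded error, grows like \<open>\<alpha> s\<close>.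

  That the backward orbit exists and is unique comes from two facts: each \<open>\<phi>\<^sub>t\<close> is injective, since
  \<open>\<phi>\<^sub>\<epsilon>\<close> is close to the identity for small \<open>\<epsilon>\<close>, and the preimage of a point of a petal
  lies in the same petal. Both hold for elliptic semigroups too, which have no Koenigs function of
  the above kind.
\<close>


section \<open>The hyperbolic metric of the disk\<close>

text \<open>The pseudo-hyperbolic distance. It is an increasing function of \<^const>\<open>hyp_dist\<close>, and unlike it
  it is algebraic in its arguments.\<close>
definition pseudo_dist :: "complex \<Rightarrow> complex \<Rightarrow> real" where
  "pseudo_dist a b = cmod ((a - b) / (1 - cnj a * b))"

lemma hyp_dist_eq_artanh: "hyp_dist a b = artanh (pseudo_dist a b)"
  by (simp add: hyp_dist_def pseudo_dist_def)

lemma pseudo_dist_nonneg: "0 \<le> pseudo_dist a b"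
  by (simp add: pseudo_dist_def)

lemma pseudo_dist_zero_left: "pseudo_dist 0 b = cmod b"
  by (simp add: pseudo_dist_def)

lemma one_minus_cnj_mult_ne_0:
  assumes "cmod a \<le> 1" "cmod b \<le> 1" "cmod a < 1 \<or> cmod b < 1"
  shows "1 - cnj a * b \<noteq> 0"
proof -
  have "cmod a * cmod b \<le> cmod a" "cmod a * cmod b \<le> cmod b"
    using assms by (simp_all add: mult_left_le mult_left_le_one_le)
  then have "cmod (cnj a * b) < 1"
    unfolding norm_mult using assms(3) by auto
  then show ?thesis
    by auto
qed

lemma norm_one_minus_cnj_mult_commute: "cmod (1 - cnj a * b) = cmod (1 - cnj b * a)"
proof -
  have "cnj (1 - cnj a * b) = 1 - cnj b * a"
    by simp
  then show ?thesis
    by (metis complex_mod_cnj)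
qed

lemma pseudo_dist_commute: "pseudo_dist a b = pseudo_dist b a"
  unfolding pseudo_dist_def norm_divide
  using norm_one_minus_cnj_mult_commute[of a b] norm_minus_commute[of a b] by metis

lemma norm_one_minus_cnj_mult_sq:
  "(cmod (1 - cnj a * b))\<^sup>2 = (1 - (cmod a)\<^sup>2) * (1 - (cmod b)\<^sup>2) + (cmod (a - b))\<^sup>2"
  unfolding cmod_power2 by (simp add: power2_eq_square algebra_simps)

text \<open>Most estimates below rest on this identity, which splits \<open>1 - pseudo_dist\<^sup>2\<close> into one factor for
  each point and a single mixed factor.\<close>
lemma one_minus_pseudo_dist_sq:
  assumes "cmod a < 1" "cmod b < 1"
  shows "1 - (pseudo_dist a b)\<^sup>2
    = (1 - (cmod a)\<^sup>2) * (1 - (cmod b)\<^sup>2) / (cmod (1 - cnj a * b))\<^sup>2"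
proof -
  have "(cmod (1 - cnj a * b))\<^sup>2 \<noteq> 0"
    using one_minus_cnj_mult_ne_0[of a b] assms by auto
  then show ?thesis
    unfolding pseudo_dist_def norm_divide power_divide
    using norm_one_minus_cnj_mult_sq[of a b] by (simp add: field_simps)
qed

lemma one_minus_norm_sq_pos: "cmod a < 1 \<Longrightarrow> 0 < 1 - (cmod a)\<^sup>2"
  by (simp add: power_less_one_iff)

lemma pseudo_dist_less_1:
  assumes "cmod a < 1" "cmod b < 1"
  shows "pseudo_dist a b < 1"
proof -
  have "0 < (cmod (1 - cnj a * b))\<^sup>2"
    using one_minus_cnj_mult_ne_0[of a b] assms by auto
  then have "0 < 1 - (pseudo_dist a b)\<^sup>2"
    using one_minus_norm_sq_pos assms by (simp add: one_minus_pseudo_dist_sq)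
  then show ?thesis
    using pseudo_dist_nonneg[of a b] by (simp add: power_less_one_iff)
qed

lemma artanh_real_strict_mono:
  fixes x y :: real
  assumes "-1 < x" "x < y" "y < 1"
  shows "artanh x < artanh y"
proof -
  have "(1 + x) / (1 - x) < (1 + y) / (1 - y)"
    using assms by (simp add: field_simps)
  moreover have "0 < (1 + x) / (1 - x)"
    using assms by simp
  ultimately show ?thesis
    unfolding artanh_def by simp
qed

lemma artanh_real_mono:
  fixes x y :: real
  assumes "-1 < x" "x \<le> y" "y < 1"
  shows "artanh x \<le> artanh y"
  using artanh_real_strict_mono[of x y] assms by (cases "x = y") auto

lemma artanh_real_nonneg: "0 \<le> x \<Longrightarrow> x < 1 \<Longrightarrow> 0 \<le> artanh (x :: real)"
  using artanh_real_mono[of 0 x] by simp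

lemma artanh_real_eq_iff:
  fixes x y :: real
  assumes "-1 < x" "x < 1" "-1 < y" "y < 1"
  shows "artanh x = artanh y \<longleftrightarrow> x = y"
  using artanh_real_strict_mono[of x y] artanh_real_strict_mono[of y x] assms
  by (metis less_irrefl linorder_neqE_linordered_idom)

text \<open>With \<open>v = (x + y) / (1 + x y)\<close> one has \<open>1 + v = (1 + x) (1 + y) / (1 + x y)\<close>, and likewise with
  minus signs; \<^const>\<open>artanh\<close> is half the logarithm of the quotient.\<close>
lemma artanh_real_add:
  fixes x y :: real
  assumes "0 \<le> x" "x < 1" "0 \<le> y" "y < 1"
  shows "artanh x + artanh y = artanh ((x + y) / (1 + x * y))"
proof -
  have p: "0 < 1 + x * y"
    using assms by (simp add: add_pos_nonneg)
  have "(1 + (x + y) / (1 + x * y)) / (1 - (x + y) / (1 + x * y))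
      = ((1 + x) * (1 + y) / (1 + x * y)) / ((1 - x) * (1 - y) / (1 + x * y))"
    using p by (simp add: field_simps)
  also have "\<dots> = ((1 + x) / (1 - x)) * ((1 + y) / (1 - y))"
    using p by simp
  finally have eq: "(1 + (x + y) / (1 + x * y)) / (1 - (x + y) / (1 + x * y))
      = ((1 + x) / (1 - x)) * ((1 + y) / (1 - y))" .
  show ?thesis
    unfolding artanh_def eq using assms by (subst ln_mult) (simp_all add: field_simps)
qed

lemma velocity_sum_less_1:
  fixes x y :: real
  assumes "0 \<le> x" "x < 1" "0 \<le> y" "y < 1"
  shows "(x + y) / (1 + x * y) < 1"
proof -
  have "0 < (1 - x) * (1 - y)"
    using assms by simp
  moreover have "0 < 1 + x * y"
    using assms by (simp add: add_pos_nonneg)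
  ultimately show ?thesis
    by (simp add: field_simps)
qed

lemma artanh_real_ge_ln:
  fixes x :: real
  assumes "0 \<le> x" "x < 1"
  shows "- ln (1 - x) \<le> 2 * artanh x"
  unfolding artanh_def using assms by (simp add: ln_div)

lemma artanh_real_le_ln:
  fixes x :: real
  assumes "0 \<le> x" "x < 1"
  shows "2 * artanh x \<le> ln 2 - ln (1 - x)"
  unfolding artanh_def using assms by (simp add: ln_div)

text \<open>The triangle inequality through the origin, before applying \<^const>\<open>artanh\<close>. The squares of
  both sides have the shape \<open>1 - N / d\<^sup>2\<close> with the same \<open>N\<close>, so one only compares \<open>|1 - cnj a c|\<close> with \<open>1 + |a| |c|\<close>; equality
  forces \<open>cnj a c\<close> to be a nonpositive real, that is, the origin separates the two points on a
  diameter.\<close>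
lemma pseudo_dist_le_velocity_sum:
  assumes "cmod a < 1" "cmod c < 1"
  shows "pseudo_dist a c \<le> (cmod a + cmod c) / (1 + cmod a * cmod c)"
    and "pseudo_dist a c = (cmod a + cmod c) / (1 + cmod a * cmod c)
      \<Longrightarrow> cnj a * c = - of_real (cmod a * cmod c)"
proof -
  define v where "v = (cmod a + cmod c) / (1 + cmod a * cmod c)"
  define N where "N = (1 - (cmod a)\<^sup>2) * (1 - (cmod c)\<^sup>2)"
  have p: "0 < 1 + cmod a * cmod c"
    by (simp add: add_pos_nonneg)
  have v0: "0 \<le> v"
    using p by (simp add: v_def)
  have N: "0 < N"
    using one_minus_norm_sq_pos assms by (simp add: N_def)
  have v: "1 - v\<^sup>2 = N / (1 + cmod a * cmod c)\<^sup>2"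
  proof -
    have N_eq: "N = (1 + cmod a * cmod c)\<^sup>2 - (cmod a + cmod c)\<^sup>2"
      unfolding N_def by (simp add: power2_eq_square algebra_simps)
    show ?thesis
      unfolding N_eq using p by (simp add: v_def power_divide diff_divide_distrib)
  qed
  have P: "1 - (pseudo_dist a c)\<^sup>2 = N / (cmod (1 - cnj a * c))\<^sup>2"
    unfolding N_def using one_minus_pseudo_dist_sq assms .
  have q: "0 < cmod (1 - cnj a * c)"
    using one_minus_cnj_mult_ne_0[of a c] assms by auto
  have le: "cmod (1 - cnj a * c) \<le> 1 + cmod a * cmod c"
    by (metis complex_mod_cnj norm_mult norm_one norm_triangle_ineq4)
  have "N / (1 + cmod a * cmod c)\<^sup>2 \<le> N / (cmod (1 - cnj a * c))\<^sup>2"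
    using N q le p by (intro divide_left_mono power_mono) auto
  then have "(pseudo_dist a c)\<^sup>2 \<le> v\<^sup>2"
    using v P by linarith
  then show "pseudo_dist a c \<le> (cmod a + cmod c) / (1 + cmod a * cmod c)"
    using v0 unfolding v_def[symmetric] by (rule power2_le_imp_le)
  show "cnj a * c = - of_real (cmod a * cmod c)"
    if "pseudo_dist a c = (cmod a + cmod c) / (1 + cmod a * cmod c)"
  proof -
    have "(cmod (1 - cnj a * c))\<^sup>2 = (1 + cmod a * cmod c)\<^sup>2"
      using v P that N p q unfolding v_def[symmetric]
      by (metis divide_cancel_left less_irrefl)
    then have eq: "(cmod (1 - cnj a * c))\<^sup>2 = (1 + cmod (cnj a * c))\<^sup>2"
      by (simp add: norm_mult)
    define \<zeta> where "\<zeta> = cnj a * c"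
    have r: "cmod \<zeta> = - Re \<zeta>"
      using eq unfolding \<zeta>_def[symmetric] 
      by (simp add: cmod_power2 power2_sum) 
         (simp add: power2_eq_square algebra_simps cmod_def)
    then have "(cmod \<zeta>)\<^sup>2 = (Re \<zeta>)\<^sup>2"
      by simp
    then have "Im \<zeta> = 0"
      by (simp add: cmod_power2)
    then have "\<zeta> = - of_real (cmod \<zeta>)"
      using r by (simp add: complex_eq_iff)
    then show ?thesis
      unfolding \<zeta>_def by (simp add: norm_mult)
  qed
qed

abbreviation disk_moebius :: "complex \<Rightarrow> complex \<Rightarrow> complex" where
  "disk_moebius \<equiv> Moebius_function 0"

lemma norm_disk_moebius: "cmod (disk_moebius c a) = pseudo_dist c a"
  by (simp add: Moebius_function_simple pseudo_dist_def norm_divide norm_minus_commute)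

lemma disk_moebius_diff:
  assumes "cmod c < 1" "cmod a \<le> 1" "cmod b \<le> 1"
  shows "disk_moebius c a - disk_moebius c b
    = (1 - cnj c * c) * (a - b) / ((1 - cnj c * a) * (1 - cnj c * b))"
proof -
  have "1 - cnj c * a \<noteq> 0" "1 - cnj c * b \<noteq> 0"
    using one_minus_cnj_mult_ne_0 assms by auto
  then show ?thesis
    unfolding Moebius_function_simple by (simp add: divide_simps) (simp add: algebra_simps)
qed

lemma pseudo_dist_disk_moebius:
  assumes "cmod c < 1" "cmod a < 1" "cmod b < 1"
  shows "pseudo_dist (disk_moebius c a) (disk_moebius c b) = pseudo_dist a b"
proof -
  have nz: "1 - cnj c * a \<noteq> 0" "1 - cnj c * b \<noteq> 0" "1 - cnj a * c \<noteq> 0" "1 - cnj c * c \<noteq> 0"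
      "1 - cnj a * b \<noteq> 0"
    using one_minus_cnj_mult_ne_0 assms by auto
  have "1 - cnj (disk_moebius c a) * disk_moebius c b
      = (1 - cnj c * c) * (1 - cnj a * b) / ((1 - cnj a * c) * (1 - cnj c * b))"
    unfolding Moebius_function_simple using nz
    by (simp add: divide_simps mult.commute[of c "cnj a"]) (simp add: algebra_simps)
  then have "cmod (1 - cnj (disk_moebius c a) * disk_moebius c b)
      = cmod (1 - cnj c * c) * cmod (1 - cnj a * b) / (cmod (1 - cnj c * a) * cmod (1 - cnj c * b))"
    by (simp add: norm_mult norm_divide norm_one_minus_cnj_mult_commute[of a c])
  moreover have "cmod (disk_moebius c a - disk_moebius c b)
      = cmod (1 - cnj c * c) * cmod (a - b) / (cmod (1 - cnj c * a) * cmod (1 - cnj c * b))"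
    using disk_moebius_diff[of c a b] assms by (simp add: norm_mult norm_divide)
  ultimately show ?thesis
    unfolding pseudo_dist_def norm_divide using nz by simp
qed

lemma hyp_dist_disk_moebius:
  assumes "cmod c < 1" "cmod a < 1" "cmod b < 1"
  shows "hyp_dist (disk_moebius c a) (disk_moebius c b) = hyp_dist a b"
  using pseudo_dist_disk_moebius assms by (simp add: hyp_dist_eq_artanh)

lemma hyp_dist_nonneg:
  assumes "cmod a < 1" "cmod b < 1"
  shows "0 \<le> hyp_dist a b"
  unfolding hyp_dist_eq_artanh
  using pseudo_dist_less_1 assms pseudo_dist_nonneg by (intro artanh_real_nonneg) auto

lemma hyp_dist_commute: "hyp_dist a b = hyp_dist b a"
  by (simp add: hyp_dist_eq_artanh pseudo_dist_commute)

lemma hyp_dist_triangle_0: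
  assumes "cmod a < 1" "cmod c < 1"
  shows "hyp_dist a c \<le> hyp_dist a 0 + hyp_dist 0 c"
    and "hyp_dist a c = hyp_dist a 0 + hyp_dist 0 c
      \<Longrightarrow> cnj a * c = - of_real (cmod a * cmod c)"
proof -
  define v where "v = (cmod a + cmod c) / (1 + cmod a * cmod c)"
  have sum: "hyp_dist a 0 + hyp_dist 0 c = artanh v"
    using assms artanh_real_add[of "cmod a" "cmod c"]
    by (simp add: v_def hyp_dist_eq_artanh pseudo_dist_commute[of a] pseudo_dist_zero_left)
  have v1: "v < 1"
    unfolding v_def using assms by (intro velocity_sum_less_1) auto
  have le: "pseudo_dist a c \<le> v"
    using pseudo_dist_le_velocity_sum(1)[OF assms] by (simp add: v_def)
  have p: "0 \<le> pseudo_dist a c"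
    by (rule pseudo_dist_nonneg)
  show "hyp_dist a c \<le> hyp_dist a 0 + hyp_dist 0 c"
    unfolding sum unfolding hyp_dist_eq_artanh using p le v1 by (intro artanh_real_mono) auto
  show "cnj a * c = - of_real (cmod a * cmod c)"
    if "hyp_dist a c = hyp_dist a 0 + hyp_dist 0 c"
  proof -
    have "pseudo_dist a c = v"
      using that p le v1 artanh_real_eq_iff[of "pseudo_dist a c" v]
      unfolding sum unfolding hyp_dist_eq_artanh by auto
    then show ?thesis
      using pseudo_dist_le_velocity_sum(2)[OF assms] by (simp add: v_def)
  qed
qed

lemma hyp_dist_triangle:
  assumes "cmod a < 1" "cmod b < 1" "cmod c < 1"
  shows "hyp_dist a c \<le> hyp_dist a b + hyp_dist b c"
proof -
  have "disk_moebius b b = 0"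
    by (simp add: Moebius_function_eq_zero)
  then show ?thesis
    using hyp_dist_triangle_0(1)[of "disk_moebius b a" "disk_moebius b c"] assms
      hyp_dist_disk_moebius[of b] Moebius_function_norm_lt_1[of b] by metis
qed

lemma norm_diff_le_pseudo_dist:
  assumes "cmod a < 1" "cmod b < 1"
  shows "cmod (a - b) \<le> 2 * pseudo_dist a b"
proof -
  have "cmod (1 - cnj a * b) \<le> 1 + cmod a * cmod b"
    by (metis complex_mod_cnj norm_mult norm_one norm_triangle_ineq4)
  also have "\<dots> \<le> 2"
    using assms mult_le_one[of "cmod a" "cmod b"] by simp
  finally have le: "cmod (1 - cnj a * b) \<le> 2" .
  have "1 - cnj a * b \<noteq> 0"
    using one_minus_cnj_mult_ne_0 assms by auto
  then have "cmod (a - b) = cmod (1 - cnj a * b) * pseudo_dist a b"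
    by (simp add: pseudo_dist_def norm_divide)
  also have "\<dots> \<le> 2 * pseudo_dist a b"
    using le pseudo_dist_nonneg by (intro mult_right_mono) auto
  finally show ?thesis .
qed

text \<open>A hyperbolic disk of fixed radius around \<open>a\<close> has Euclidean size at most a multiple of the
  distance of \<open>a\<close> to the unit circle.\<close>
lemma norm_diff_le_of_pseudo_dist_half:
  assumes "cmod a < 1" "cmod b < 1" "pseudo_dist a b \<le> 1/2"
  shows "cmod (a - b) \<le> 2 * (1 - cmod a)"
proof -
  have "1 - cnj a * b = of_real (1 - (cmod a)\<^sup>2) + cnj a * (a - b)"
    using complex_norm_square[of a] by (simp add: algebra_simps)
  then have "cmod (1 - cnj a * b) \<le> cmod (of_real (1 - (cmod a)\<^sup>2)) + cmod (cnj a * (a - b))"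
    by (metis norm_triangle_ineq)
  also have "\<dots> = (1 - (cmod a)\<^sup>2) + cmod a * cmod (a - b)"
    unfolding norm_of_real norm_mult using one_minus_norm_sq_pos[OF assms(1)] by simp
  also have "cmod a * cmod (a - b) \<le> 1 * cmod (a - b)"
    using assms by (intro mult_right_mono) auto
  finally have 1: "cmod (1 - cnj a * b) \<le> (1 - (cmod a)\<^sup>2) + cmod (a - b)"
    by simp
  have "1 - cnj a * b \<noteq> 0"
    using one_minus_cnj_mult_ne_0 assms by auto
  then have "cmod (a - b) \<le> 1/2 * cmod (1 - cnj a * b)"
    using assms(3) by (simp add: pseudo_dist_def norm_divide field_simps)
  then have "cmod (a - b) \<le> 1 - (cmod a)\<^sup>2"
    using 1 by simp
  also have "\<dots> = (1 + cmod a) * (1 - cmod a)"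
    by (simp add: power2_eq_square algebra_simps)
  also have "\<dots> \<le> 2 * (1 - cmod a)"
    using assms by (intro mult_right_mono) auto
  finally show ?thesis .
qed

text \<open>The form of the Schwarz--Pick lemma in which the domain is an arbitrary disk and one of the
  points is its centre: normalise the image of the centre to \<open>0\<close> and apply the Schwarz lemma.\<close>
lemma Schwarz_Pick_ball:
  assumes f: "f holomorphic_on ball c r" "f ` ball c r \<subseteq> unit_disk" and b: "b \<in> ball c r"
  shows "pseudo_dist (f c) (f b) \<le> cmod (b - c) / r"
proof -
  have r: "0 < r"
    using b by (metis ball_eq_empty empty_iff not_le)
  have inb: "c + of_real r * \<zeta> \<in> ball c r" if "cmod \<zeta> < 1" for \<zeta>
    using that r by (simp add: dist_norm norm_mult)
  have fn: "cmod (f \<zeta>) < 1" if "\<zeta> \<in> ball c r" for \<zeta>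
    using f(2) that by (auto simp: image_subset_iff)
  have fc: "cmod (f c) < 1"
    using fn r by simp
  define g where "g = (\<lambda>\<zeta>. disk_moebius (f c) (f (c + of_real r * \<zeta>)))"
  have "(\<lambda>\<zeta>. c + of_real r * \<zeta>) holomorphic_on ball 0 1"
    by (intro holomorphic_intros)
  then have "(\<lambda>\<zeta>. f (c + of_real r * \<zeta>)) holomorphic_on ball 0 1"
    using holomorphic_on_compose_gen[of "\<lambda>\<zeta>. c + of_real r * \<zeta>" "ball 0 1" f "ball c r"] f(1) inb
    by (auto simp: o_def image_subset_iff)
  then have "g holomorphic_on ball 0 1"
    unfolding g_def
    using holomorphic_on_compose_gen[of "\<lambda>\<zeta>. f (c + of_real r * \<zeta>)" "ball 0 1"
        "disk_moebius (f c)" "ball 0 1"] Moebius_function_holomorphic[OF fc] fn inb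
    by (auto simp: o_def image_subset_iff)
  moreover have "g 0 = 0"
    by (simp add: g_def Moebius_function_eq_zero)
  moreover have "cmod (g \<zeta>) < 1" if "cmod \<zeta> < 1" for \<zeta>
    unfolding g_def using fc fn inb that by (intro Moebius_function_norm_lt_1) auto
  moreover have bz: "cmod ((b - c) / of_real r) < 1"
    using b r by (simp add: norm_divide dist_norm norm_minus_commute)
  ultimately have "cmod (g ((b - c) / of_real r)) \<le> cmod ((b - c) / of_real r)"
    by (rule Schwarz_Lemma)
  then show ?thesis
    using r by (simp add: g_def norm_disk_moebius norm_divide)
qed

lemma Schwarz_Pick:
  assumes f: "f holomorphic_on unit_disk" "f ` unit_disk \<subseteq> unit_disk"
    and ab: "cmod a < 1" "cmod b < 1"
  shows "pseudo_dist (f a) (f b) \<le> pseudo_dist a b"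
proof -
  define g where "g = (\<lambda>\<zeta>. f (disk_moebius (-a) \<zeta>))"
  have inb: "disk_moebius (-a) \<zeta> \<in> unit_disk" if "cmod \<zeta> < 1" for \<zeta>
    using Moebius_function_norm_lt_1[of "-a" \<zeta>] ab that by simp
  have "g holomorphic_on unit_disk"
    unfolding g_def
    using holomorphic_on_compose_gen[of "disk_moebius (-a)" "ball 0 1" f "ball 0 1"] f(1) inb
      Moebius_function_holomorphic[of "-a"] ab by (auto simp: o_def image_subset_iff)
  moreover have "g ` unit_disk \<subseteq> unit_disk"
    unfolding g_def using inb f(2) by auto
  moreover have "disk_moebius a b \<in> unit_disk"
    using Moebius_function_norm_lt_1[of a b] ab by simp
  ultimately have "pseudo_dist (g 0) (g (disk_moebius a b)) \<le> cmod (disk_moebius a b - 0) / 1"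
    by (rule Schwarz_Pick_ball)
  moreover have "g 0 = f a"
    by (simp add: g_def Moebius_function_of_zero)
  moreover have "g (disk_moebius a b) = f b"
    using Moebius_function_compose[of "-a" a b] ab by (simp add: g_def)
  ultimately show ?thesis
    by (simp add: norm_disk_moebius)
qed


section \<open>Geodesics and projections onto them\<close>

text \<open>Turns divergence of the hyperbolic distance from the origin into convergence of the modulus
  to \<open>1\<close>.\<close>
lemma one_minus_le_exp_artanh:
  fixes x :: real
  assumes "0 \<le> x" "x < 1"
  shows "1 - x \<le> 2 * exp (- 2 * artanh x)"
proof -
  have "ln (1 - x) \<le> ln 2 - 2 * artanh x"
    using artanh_real_le_ln[OF assms] by simp
  then have "exp (ln (1 - x)) \<le> exp (ln 2 + - 2 * artanh x)"
    by simp
  then show ?thesis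
    unfolding exp_add using assms by simp
qed

text \<open>After moving \<open>\<eta> 0\<close> to the origin a geodesic becomes a diameter. For \<open>s < 0 < t\<close> the
  additivity of the distance is a case of equality in the triangle inequality through \<open>0\<close>, so the
  two images lie on opposite rays; fixing one of the two parameters shows that the rays do not depend on
  the other. As both ends have infinite length, the whole diameter is covered.\<close>
lemma full_geodesic_in_moebius_coordinates:
  assumes \<eta>: "full_geodesic \<eta>"
  obtains u where "cmod u = 1"
    and "(\<lambda>r. disk_moebius (\<eta> 0) (\<eta> r)) ` {-1<..<1} = (\<lambda>x. of_real x * u) ` {-1<..<1}"
    and "((\<lambda>r. disk_moebius (\<eta> 0) (\<eta> r)) \<longlongrightarrow> u) (at_left 1)"
proof -
  define \<xi> where "\<xi> = (\<lambda>r. disk_moebius (\<eta> 0) (\<eta> r))"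
  have \<eta>1: "cmod (\<eta> r) < 1" if "r \<in> {-1<..<1}" for r
    using \<eta> that unfolding full_geodesic_def image_subset_iff by simp
  have a1: "cmod (\<eta> 0) < 1"
    by (simp add: \<eta>1)
  have \<xi>1: "cmod (\<xi> r) < 1" if "r \<in> {-1<..<1}" for r
    unfolding \<xi>_def using a1 \<eta>1[OF that] by (rule Moebius_function_norm_lt_1)
  have \<xi>0: "\<xi> 0 = 0"
    by (simp add: \<xi>_def Moebius_function_eq_zero)
  have d: "hyp_dist (\<xi> r) (\<xi> t) = hyp_dist (\<eta> r) (\<eta> t)" if "r \<in> {-1<..<1}" "t \<in> {-1<..<1}" for r t
    unfolding \<xi>_def using a1 \<eta>1[OF that(1)] \<eta>1[OF that(2)] by (rule hyp_dist_disk_moebius)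
  have cont\<eta>: "continuous_on {-1<..<1} \<eta>"
    using \<eta> by (simp add: full_geodesic_def)
  have cont: "continuous_on {-1<..<1} \<xi>"
    unfolding \<xi>_def
  proof (rule continuous_on_compose2[OF _ cont\<eta>])
    show "continuous_on (ball 0 1) (disk_moebius (\<eta> 0))"
      by (intro holomorphic_on_imp_continuous_on Moebius_function_holomorphic a1)
    show "\<eta> ` {-1<..<1} \<subseteq> ball 0 1"
      using \<eta>1 by (simp add: image_subset_iff)
  qed
  have opp: "cnj (\<xi> s) * \<xi> t = - of_real (cmod (\<xi> s) * cmod (\<xi> t))"
    if "-1 < s" "s < 0" "0 < t" "t < 1" for s t
  proof (rule hyp_dist_triangle_0(2))
    have "hyp_dist (\<eta> s) (\<eta> t) = hyp_dist (\<eta> s) (\<eta> 0) + hyp_dist (\<eta> 0) (\<eta> t)"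
      using \<eta> that unfolding full_geodesic_def by simp
    then show "hyp_dist (\<xi> s) (\<xi> t) = hyp_dist (\<xi> s) 0 + hyp_dist 0 (\<xi> t)"
      using d[of s t] d[of s 0] d[of 0 t] that \<xi>0 by simp
  qed (use \<xi>1 that in auto)
  have nz: "\<xi> r \<noteq> 0" if "r \<in> {-1<..<1}" "r \<noteq> 0" for r
  proof
    assume "\<xi> r = 0"
    moreover have "1 - cnj (\<eta> 0) * \<eta> r \<noteq> 0"
      using one_minus_cnj_mult_ne_0[of "\<eta> 0" "\<eta> r"] a1 \<eta>1[OF that(1)] by auto
    ultimately have "\<eta> r = \<eta> 0"
      by (simp add: \<xi>_def Moebius_function_simple)
    then show False
      using \<eta> that unfolding full_geodesic_def inj_on_def by auto
  qed
  \<comment> \<open>The ray opposite to one point with negative parameter contains all points with positive parameter.\<close>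
  define u where "u = - sgn (\<xi> (-1/2))"
  have u1: "cmod u = 1"
    using nz[of "-1/2"] by (simp add: u_def norm_sgn)
  have uu: "u * cnj u = 1"
    using complex_norm_square[of u] u1 by simp
  have pos: "\<xi> t = of_real (cmod (\<xi> t)) * u" if "0 < t" "t < 1" for t
  proof -
    have "\<xi> (-1/2) = - of_real (cmod (\<xi> (-1/2))) * u"
      using nz[of "-1/2"] by (simp add: u_def sgn_eq)
    moreover have "- of_real (cmod (\<xi> (-1/2))) * cnj u * \<xi> t
        = - of_real (cmod (\<xi> (-1/2))) * of_real (cmod (\<xi> t))"
    proof -
      have "cnj (\<xi> (-1/2)) = - of_real (cmod (\<xi> (-1/2))) * cnj u"
        using calculation by (metis complex_cnj_complex_of_real complex_cnj_minus complex_cnj_mult)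
      then show ?thesis
        using opp[of "-1/2" t] that by simp
    qed
    ultimately have "cnj u * \<xi> t = of_real (cmod (\<xi> t))"
      using nz[of "-1/2"] by simp
    then have "u * cnj u * \<xi> t = of_real (cmod (\<xi> t)) * u"
      by (simp add: mult.assoc mult.commute)
    then show ?thesis
      by (simp add: uu)
  qed
  have neg: "\<xi> s = - of_real (cmod (\<xi> s)) * u" if "-1 < s" "s < 0" for s
  proof -
    have "cnj (\<xi> s) * (of_real (cmod (\<xi> (1/2))) * u) = - of_real (cmod (\<xi> s) * cmod (\<xi> (1/2)))"
      using opp[of s "1/2"] pos[of "1/2"] that by simp
    then have "of_real (cmod (\<xi> (1/2))) * (cnj (\<xi> s) * u)
        = of_real (cmod (\<xi> (1/2))) * (- of_real (cmod (\<xi> s)))"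
      by (simp add: algebra_simps)
    then have "cnj (\<xi> s) * u = - of_real (cmod (\<xi> s))"
      using nz[of "1/2"] by (subst (asm) mult_left_cancel) auto
    then have "cnj (cnj (\<xi> s) * u) = cnj (- of_real (cmod (\<xi> s)))"
      by simp
    then have "\<xi> s * (u * cnj u) = - of_real (cmod (\<xi> s)) * u"
      by (simp add: algebra_simps)
    then show ?thesis
      by (simp add: uu)
  qed
  define x where "x = (\<lambda>r. Re (\<xi> r * cnj u))"
  have xpos: "x t = cmod (\<xi> t)" if "0 < t" "t < 1" for t
  proof -
    have "\<xi> t * cnj u = of_real (cmod (\<xi> t)) * (u * cnj u)"
      using pos[OF that] by (metis mult.assoc)
    then have eq: "\<xi> t * cnj u = of_real (cmod (\<xi> t))"
      by (simp add: uu)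
    show ?thesis
      unfolding x_def eq by simp
  qed
  have xneg: "x t = - cmod (\<xi> t)" if "-1 < t" "t < 0" for t
  proof -
    have "\<xi> t * cnj u = - of_real (cmod (\<xi> t)) * (u * cnj u)"
      using neg[OF that] by (metis mult.assoc)
    then have eq: "\<xi> t * cnj u = - of_real (cmod (\<xi> t))"
      by (simp add: uu)
    show ?thesis
      unfolding x_def eq by simp
  qed
  have \<xi>x: "\<xi> r = of_real (x r) * u" if "r \<in> {-1<..<1}" for r
    using pos[of r] neg[of r] xpos[of r] xneg[of r] \<xi>0 that
    by (cases "r < 0"; cases "r = 0") (auto simp: x_def)
  have x1: "\<bar>x r\<bar> < 1" if "r \<in> {-1<..<1}" for r
    using \<xi>1[OF that] \<xi>x[OF that] u1 by (metis mult.right_neutral norm_mult norm_of_real)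
  have contx: "continuous_on {-1<..<1} x"
    unfolding x_def by (intro continuous_intros cont)
  have lim1: "((\<lambda>r. cmod (\<xi> r)) \<longlongrightarrow> 1) F"
    if F: "filterlim (\<lambda>r. hyp_dist (\<eta> 0) (\<eta> r)) at_top F"
      and ev: "eventually (\<lambda>r. r \<in> {-1<..<1}) F" for F
  proof -
    have "((\<lambda>r. 2 * exp (- (2 * hyp_dist (\<eta> 0) (\<eta> r)))) \<longlongrightarrow> 2 * 0) F"
      using F by (intro tendsto_mult tendsto_const filterlim_compose[OF exp_at_bot])
        (simp add: filterlim_uminus_at_bot filterlim_tendsto_pos_mult_at_top[OF tendsto_const])
    then have "((\<lambda>r. 1 - 2 * exp (- (2 * hyp_dist (\<eta> 0) (\<eta> r)))) \<longlongrightarrow> 1 - 0) F"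
      by (intro tendsto_diff tendsto_const) auto
    moreover have "eventually (\<lambda>r. 1 - 2 * exp (- (2 * hyp_dist (\<eta> 0) (\<eta> r))) \<le> cmod (\<xi> r)) F"
      using ev
    proof eventually_elim
      case (elim r)
      have "hyp_dist (\<eta> 0) (\<eta> r) = artanh (cmod (\<xi> r))"
        by (simp add: hyp_dist_eq_artanh \<xi>_def norm_disk_moebius)
      then show ?case
        using one_minus_le_exp_artanh[of "cmod (\<xi> r)"] \<xi>1[OF elim] by simp
    qed
    moreover have "eventually (\<lambda>r. cmod (\<xi> r) \<le> 1) F"
      using ev by eventually_elim (use \<xi>1 less_imp_le in blast)
    ultimately show ?thesis
      by (intro tendsto_sandwich[of _ "\<lambda>r. cmod (\<xi> r)" F "\<lambda>_. 1"]) auto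
  qed
  have evl: "eventually (\<lambda>r. r \<in> {0<..<1}) (at_left (1::real))"
    by (rule eventually_at_leftI[of 0]) auto
  have evr: "eventually (\<lambda>r. r \<in> {-1<..<0}) (at_right (-1::real))"
    by (rule eventually_at_rightI[of _ 0]) auto
  have liml: "((\<lambda>r. cmod (\<xi> r)) \<longlongrightarrow> 1) (at_left 1)"
    using \<eta> evl by (intro lim1) (auto simp: full_geodesic_def elim: eventually_mono)
  have limr: "((\<lambda>r. cmod (\<xi> r)) \<longlongrightarrow> 1) (at_right (-1))"
    using \<eta> evr by (intro lim1) (auto simp: full_geodesic_def elim: eventually_mono)
  have x_image: "x ` {-1<..<1} = {-1<..<1}"
  proof
    show "x ` {-1<..<1} \<subseteq> {-1<..<1}"
    proof (rule image_subsetI)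
      fix r :: real assume "r \<in> {-1<..<1}"
      from x1[OF this] show "x r \<in> {-1<..<1}"
        unfolding abs_less_iff greaterThanLessThan_iff by linarith
    qed
    show "{-1<..<1} \<subseteq> x ` {-1<..<1}"
    proof
      fix y :: real assume y: "y \<in> {-1<..<1}"
      have "eventually (\<lambda>r. y < cmod (\<xi> r)) (at_left 1)"
        using liml y by (intro order_tendstoD(1)) auto
      then have "eventually (\<lambda>r. y < cmod (\<xi> r) \<and> r \<in> {0<..<1}) (at_left 1)"
        using evl by (rule eventually_conj)
      then obtain r where r: "y < cmod (\<xi> r)" "0 < r" "r < 1"
        using eventually_happens'[OF trivial_limit_at_left_real] by fastforce
      have "eventually (\<lambda>r. - y < cmod (\<xi> r)) (at_right (-1))"
        using limr y by (intro order_tendstoD(1)) auto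
      then have "eventually (\<lambda>r. - y < cmod (\<xi> r) \<and> r \<in> {-1<..<0}) (at_right (-1))"
        using evr by (rule eventually_conj)
      then obtain s where s: "- y < cmod (\<xi> s)" "-1 < s" "s < 0"
        using eventually_happens'[OF trivial_limit_at_right_real] by fastforce
      have "connected (x ` {-1<..<1})"
        using contx by (rule connected_continuous_image) simp
      moreover have "x s \<in> x ` {-1<..<1}" "x r \<in> x ` {-1<..<1}"
        using r s by auto
      moreover have "x s \<le> y" "y \<le> x r"
        using r s xpos[of r] xneg[of s] by auto
      ultimately show "y \<in> x ` {-1<..<1}"
        unfolding connected_iff_interval by blast
    qed
  qed
  show thesis
  proof
    show "cmod u = 1" by (fact u1)
    have "\<xi> ` {-1<..<1} = (\<lambda>r. of_real (x r) * u) ` {-1<..<1}"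
      using \<xi>x by (intro image_cong) auto
    also have "\<dots> = (\<lambda>x. of_real x * u) ` {-1<..<1}"
      by (subst (2) x_image[symmetric]) (simp add: image_image)
    finally show "(\<lambda>r. disk_moebius (\<eta> 0) (\<eta> r)) ` {-1<..<1} = (\<lambda>x. of_real x * u) ` {-1<..<1}"
      by (simp add: \<xi>_def)
    have "((\<lambda>r. of_real (cmod (\<xi> r)) * u) \<longlongrightarrow> of_real 1 * u) (at_left 1)"
      by (intro tendsto_intros liml)
    moreover have "eventually (\<lambda>r. of_real (cmod (\<xi> r)) * u = \<xi> r) (at_left 1)"
      using evl by eventually_elim (use pos in auto)
    ultimately have "(\<xi> \<longlongrightarrow> of_real 1 * u) (at_left 1)"
      by (rule Lim_transform_eventually)
    then show "((\<lambda>r. disk_moebius (\<eta> 0) (\<eta> r)) \<longlongrightarrow> u) (at_left 1)"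
      by (simp add: \<xi>_def)
  qed
qed

text \<open>Minimising the distance from \<open>v\<close> to \<open>x u\<close> means maximising \<open>(1 - x\<^sup>2) / (1 - 2 b x + m x\<^sup>2)\<close>
  with \<open>b = Re (cnj v u)\<close> and \<open>m = |v|\<^sup>2\<close>. The critical points satisfy \<open>b (1 + x\<^sup>2) = (1 + m) x\<close>,
  which has a root \<open>x0\<close> in \<open>(-1, 1)\<close> because \<open>2 |b| < 1 + m\<close>; comparison with the value at \<open>x0\<close>
  leaves a multiple of \<open>(x - x0)\<^sup>2\<close>, which gives strictness.\<close>
lemma diameter_projection:
  assumes v: "cmod v < 1" and u: "cmod u = 1"
  obtains x0 where "x0 \<in> {-1<..<1}"
    and "\<And>x. x \<in> {-1<..<1} \<Longrightarrow> x \<noteq> x0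
      \<Longrightarrow> pseudo_dist v (of_real x0 * u) < pseudo_dist v (of_real x * u)"
proof -
  define b where "b = Re (cnj v * u)"
  define m where "m = (cmod v)\<^sup>2"
  define Q where "Q = (\<lambda>x. 1 - 2 * b * x + m * x\<^sup>2)"
  have xu: "cmod (of_real x * u) < 1" if "x \<in> {-1<..<1}" for x
    using that u by (auto simp: norm_mult)
  have Q: "(cmod (1 - cnj v * (of_real x * u)))\<^sup>2 = Q x" for x
  proof -
    have m': "m = (cmod (cnj v * u))\<^sup>2"
      using u by (simp add: m_def norm_mult)
    show ?thesis
      unfolding Q_def m' b_def cmod_power2
      by (simp add: power2_eq_square algebra_simps)
  qed
  have Qpos: "0 < Q x" if "x \<in> {-1<..<1}" for x
    unfolding Q[symmetric] using one_minus_cnj_mult_ne_0[of v "of_real x * u"] v xu[OF that] by auto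
  have pd: "1 - (pseudo_dist v (of_real x * u))\<^sup>2 = (1 - m) * ((1 - x\<^sup>2) / Q x)"
    if "x \<in> {-1<..<1}" for x
    using one_minus_pseudo_dist_sq[OF v xu[OF that]] u by (simp add: Q m_def norm_mult)
  have m1: "0 < 1 - m"
    using one_minus_norm_sq_pos[OF v] by (simp add: m_def)
  have "\<bar>b\<bar> \<le> cmod v"
    unfolding b_def using abs_Re_le_cmod[of "cnj v * u"] u by (simp add: norm_mult)
  moreover have "2 * cmod v < 1 + m"
  proof -
    have "0 < (1 - cmod v)\<^sup>2"
      using v by simp
    then show ?thesis
      by (simp add: m_def power2_eq_square algebra_simps)
  qed
  ultimately have b: "2 * \<bar>b\<bar> < 1 + m"
    by simp
  have "\<exists>x\<ge>-1. x \<le> 1 \<and> b * (1 + x\<^sup>2) - (1 + m) * x = 0"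
    using b by (intro IVT2') (auto intro!: continuous_intros)
  then obtain x0 where x0: "-1 \<le> x0" "x0 \<le> 1" "b * (1 + x0\<^sup>2) = (1 + m) * x0"
    by auto
  have "x0 \<noteq> 1" "x0 \<noteq> -1"
    using x0(3) b by auto
  then have x0in: "x0 \<in> {-1<..<1}"
    using x0 by auto
  have key: "(1 - x\<^sup>2) / Q x < (1 - x0\<^sup>2) / Q x0" if x: "x \<in> {-1<..<1}" "x \<noteq> x0" for x
  proof -
    have "(1 + x0\<^sup>2) * ((1 - x0\<^sup>2) * Q x - (1 - x\<^sup>2) * Q x0)
        = (1 + m) * (1 - x0\<^sup>2) * (x - x0)\<^sup>2 
          + 2 * (x0 - x) * (1 + x * x0) * (b * (1 + x0\<^sup>2) - (1 + m) * x0)"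
      unfolding Q_def by algebra
    also have "\<dots> = (1 + m) * (1 - x0\<^sup>2) * (x - x0)\<^sup>2"
      using x0(3) by simp
    also have "\<dots> > 0"
      using x x0in m1 abs_square_less_1[of x0] by (intro mult_pos_pos) (auto simp: m_def add_pos_nonneg)
    finally have "0 < (1 - x0\<^sup>2) * Q x - (1 - x\<^sup>2) * Q x0"
      by (rule zero_less_mult_pos) (simp add: add_pos_nonneg)
    then show ?thesis
      using Qpos[OF x(1)] Qpos[OF x0in] by (simp add: field_simps)
  qed
  show thesis
  proof
    fix x :: real assume x: "x \<in> {-1<..<1}" "x \<noteq> x0"
    have "(1 - m) * ((1 - x\<^sup>2) / Q x) < (1 - m) * ((1 - x0\<^sup>2) / Q x0)"
      by (rule mult_strict_left_mono[OF key[OF x] m1])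
    then have "(pseudo_dist v (of_real x0 * u))\<^sup>2 < (pseudo_dist v (of_real x * u))\<^sup>2"
      using pd[OF x(1)] pd[OF x0in] by linarith
    then show "pseudo_dist v (of_real x0 * u) < pseudo_dist v (of_real x * u)"
      using pseudo_dist_nonneg by (rule power2_less_imp_less)
  qed (fact x0in)
qed

lemma dist_to_geodesic_le:
  assumes "full_geodesic \<eta>" "cmod w < 1" "r \<in> {-1<..<1}"
  shows "dist_to_geodesic w \<eta> \<le> hyp_dist w (\<eta> r)"
  unfolding dist_to_geodesic_def
proof (rule cINF_lower)
  show "bdd_below ((\<lambda>r. hyp_dist w (\<eta> r)) ` {-1<..<1})"
    using assms unfolding full_geodesic_def image_subset_iff
    by (intro bdd_belowI2[of _ 0] hyp_dist_nonneg) auto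
qed (fact assms(3))

text \<open>The nearest point on a geodesic exists and is unique, so that the definite description in
  \<^const>\<open>geodesic_projection\<close> denotes it.\<close>
lemma geodesic_projection:
  assumes \<eta>: "full_geodesic \<eta>" and w: "cmod w < 1"
  shows "geodesic_projection \<eta> w \<in> \<eta> ` {-1<..<1}"
    and "hyp_dist w (geodesic_projection \<eta> w) = dist_to_geodesic w \<eta>"
proof -
  have \<eta>1: "cmod (\<eta> r) < 1" if "r \<in> {-1<..<1}" for r
    using \<eta> that unfolding full_geodesic_def image_subset_iff by simp
  have a1: "cmod (\<eta> 0) < 1"
    by (simp add: \<eta>1)
  obtain u where u: "cmod u = 1"
    and im: "(\<lambda>r. disk_moebius (\<eta> 0) (\<eta> r)) ` {-1<..<1} = (\<lambda>x. of_real x * u) ` {-1<..<1}"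
    using full_geodesic_in_moebius_coordinates[OF \<eta>] by metis
  have "cmod (disk_moebius (\<eta> 0) w) < 1"
    using a1 w by (rule Moebius_function_norm_lt_1)
  then obtain x0 where x0: "x0 \<in> {-1<..<1}"
    and min: "\<And>x. x \<in> {-1<..<1} \<Longrightarrow> x \<noteq> x0
      \<Longrightarrow> pseudo_dist (disk_moebius (\<eta> 0) w) (of_real x0 * u)
        < pseudo_dist (disk_moebius (\<eta> 0) w) (of_real x * u)"
    using diameter_projection[OF _ u] by metis
  obtain r0 where r0: "r0 \<in> {-1<..<1}" "disk_moebius (\<eta> 0) (\<eta> r0) = of_real x0 * u"
    using x0 im by (metis (no_types, lifting) image_iff)
  have less: "hyp_dist w (\<eta> r0) < hyp_dist w (\<eta> r)" if r: "r \<in> {-1<..<1}" "\<eta> r \<noteq> \<eta> r0" for r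
  proof -
    obtain x where x: "x \<in> {-1<..<1}" "disk_moebius (\<eta> 0) (\<eta> r) = of_real x * u"
      using r(1) im by (metis (no_types, lifting) image_iff)
    have "disk_moebius (\<eta> 0) (\<eta> r) \<noteq> disk_moebius (\<eta> 0) (\<eta> r0)"
      using Moebius_function_compose[of "- \<eta> 0" "\<eta> 0"] a1 \<eta>1[OF r(1)] \<eta>1[OF r0(1)] r(2)
      by (metis minus_minus norm_minus_cancel)
    then have "x \<noteq> x0"
      using x r0 by auto
    then have "pseudo_dist w (\<eta> r0) < pseudo_dist w (\<eta> r)"
      using min[OF x(1)] pseudo_dist_disk_moebius[OF a1 w \<eta>1[OF r(1)]]
        pseudo_dist_disk_moebius[OF a1 w \<eta>1[OF r0(1)]] x(2) r0(2) by simp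
    then show ?thesis
      unfolding hyp_dist_eq_artanh
      using pseudo_dist_nonneg[of w "\<eta> r0"] pseudo_dist_less_1[OF w \<eta>1[OF r(1)]]
      by (intro artanh_real_strict_mono) auto
  qed
  have D: "dist_to_geodesic w \<eta> = hyp_dist w (\<eta> r0)"
    unfolding dist_to_geodesic_def
  proof (rule cInf_eq_minimum)
    show "hyp_dist w (\<eta> r0) \<in> (\<lambda>r. hyp_dist w (\<eta> r)) ` {-1<..<1}"
      using r0(1) by (rule imageI)
    show "hyp_dist w (\<eta> r0) \<le> d" if d: "d \<in> (\<lambda>r. hyp_dist w (\<eta> r)) ` {-1<..<1}" for d
    proof -
      obtain r where "r \<in> {-1<..<1}" "d = hyp_dist w (\<eta> r)"
        using d by blast
      then show ?thesis
        using less[of r] by (cases "\<eta> r = \<eta> r0") auto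
    qed
  qed
  have "geodesic_projection \<eta> w = \<eta> r0"
    unfolding geodesic_projection_def D
  proof (rule the_equality)
    show "\<eta> r0 \<in> \<eta> ` {-1<..<1} \<and> hyp_dist w (\<eta> r0) = hyp_dist w (\<eta> r0)"
      using r0 by simp
    show "p = \<eta> r0" if "p \<in> \<eta> ` {-1<..<1} \<and> hyp_dist w p = hyp_dist w (\<eta> r0)" for p
      using that less by force
  qed
  then show "geodesic_projection \<eta> w \<in> \<eta> ` {-1<..<1}"
    and "hyp_dist w (geodesic_projection \<eta> w) = dist_to_geodesic w \<eta>"
    using r0 D by auto
qed

text \<open>A point \<open>v\<close> that approaches \<open>u\<close> nontangentially stays at bounded distance from the radius
  ending at \<open>u\<close>: compare it with the point of the radius that has the same modulus.\<close>
lemma pseudo_dist_radial_projection_le: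
  assumes v: "cmod v < 1" and u: "cmod u = 1" and N: "cmod (v - u) \<le> N * (1 - cmod v)"
  shows "pseudo_dist v (of_real (cmod v) * u) \<le> sqrt (1 - 1 / (N + 3)\<^sup>2)"
proof -
  define b where "b = of_real (cmod v) * u"
  have b: "cmod b = cmod v"
    using u by (simp add: b_def norm_mult)
  have "0 \<le> N * (1 - cmod v)"
    using N norm_ge_zero order_trans by blast
  then have N0: "0 \<le> N"
    using v by (simp add: zero_le_mult_iff)
  have "cmod (u - b) = cmod (of_real (1 - cmod v) * u)"
    by (simp add: b_def algebra_simps)
  then have "cmod (u - b) = 1 - cmod v"
    using u v by (simp add: norm_mult del: of_real_diff)
  moreover have "cmod (v - b) \<le> cmod (v - u) + cmod (u - b)"
    using norm_triangle_ineq[of "v - u" "u - b"] by simp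
  ultimately have vb: "cmod (v - b) \<le> (N + 1) * (1 - cmod v)"
    using N by (simp add: algebra_simps)
  have "1 - cnj v * b = of_real (1 - (cmod v)\<^sup>2) + cnj v * (v - b)"
    using complex_norm_square[of v] by (simp add: algebra_simps)
  then have "cmod (1 - cnj v * b) \<le> cmod (of_real (1 - (cmod v)\<^sup>2)) + cmod (cnj v * (v - b))"
    by (metis norm_triangle_ineq)
  also have "\<dots> = (1 - (cmod v)\<^sup>2) + cmod v * cmod (v - b)"
    unfolding norm_of_real norm_mult using one_minus_norm_sq_pos[OF v] by simp
  also have "cmod v * cmod (v - b) \<le> 1 * cmod (v - b)"
    using v by (intro mult_right_mono) auto
  also have "1 - (cmod v)\<^sup>2 = (1 + cmod v) * (1 - cmod v)"
    by (simp add: power2_eq_square algebra_simps)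
  also have "(1 + cmod v) * (1 - cmod v) \<le> 2 * (1 - cmod v)"
    using v by (intro mult_right_mono) auto
  finally have le: "cmod (1 - cnj v * b) \<le> (N + 3) * (1 - cmod v)"
    using vb by (simp add: algebra_simps)
  have nz: "1 - cnj v * b \<noteq> 0"
    using one_minus_cnj_mult_ne_0[of v b] v b by auto
  have "(1 - cmod v) \<le> 1 - (cmod v)\<^sup>2"
    using v by (simp add: power2_eq_square mult_left_le)
  then have "(1 - cmod v)\<^sup>2 \<le> (1 - (cmod v)\<^sup>2)\<^sup>2"
    using v by (intro power_mono) auto
  have "1 / (N + 3)\<^sup>2 = (1 - cmod v)\<^sup>2 / ((N + 3) * (1 - cmod v))\<^sup>2"
    using v by (simp add: power_mult_distrib)
  also have "\<dots> \<le> (1 - cmod v)\<^sup>2 / (cmod (1 - cnj v * b))\<^sup>2"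
    using le nz v N0 by (intro divide_left_mono power_mono mult_pos_pos) auto
  also have "\<dots> \<le> (1 - (cmod v)\<^sup>2)\<^sup>2 / (cmod (1 - cnj v * b))\<^sup>2"
    using \<open>(1 - cmod v)\<^sup>2 \<le> (1 - (cmod v)\<^sup>2)\<^sup>2\<close> by (intro divide_right_mono) auto
  also have "\<dots> = 1 - (pseudo_dist v b)\<^sup>2"
    using one_minus_pseudo_dist_sq[of v b] v b by (simp add: power2_eq_square)
  finally have "(pseudo_dist v b)\<^sup>2 \<le> 1 - 1 / (N + 3)\<^sup>2"
    by simp
  then show ?thesis
    unfolding b_def by (rule real_le_rsqrt)
qed

text \<open>A disk automorphism is bi-Lipschitz on the closed disk, so it maps a Stolz region at \<open>\<sigma>\<close> into one
  at the image of \<open>\<sigma>\<close>; this reduces the claim to a diameter.\<close>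
lemma dist_to_geodesic_bounded_in_stolz_region:
  assumes \<eta>: "full_geodesic \<eta>" and lim: "(\<eta> \<longlongrightarrow> \<sigma>) (at_left 1)" and \<sigma>: "cmod \<sigma> = 1"
  obtains C where "\<And>w. w \<in> stolz_region \<sigma> M \<Longrightarrow> dist_to_geodesic w \<eta> \<le> C"
proof -
  define a where "a = \<eta> 0"
  have \<eta>1: "cmod (\<eta> r) < 1" if "r \<in> {-1<..<1}" for r
    using \<eta> that unfolding full_geodesic_def image_subset_iff by simp
  have a1: "cmod a < 1"
    by (simp add: \<eta>1 a_def)
  obtain u where u: "cmod u = 1"
    and im: "(\<lambda>r. disk_moebius a (\<eta> r)) ` {-1<..<1} = (\<lambda>x. of_real x * u) ` {-1<..<1}"
    and limu: "((\<lambda>r. disk_moebius a (\<eta> r)) \<longlongrightarrow> u) (at_left 1)"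
    using full_geodesic_in_moebius_coordinates[OF \<eta>] unfolding a_def by metis
  have "1 - cnj a * \<sigma> \<noteq> 0"
    using one_minus_cnj_mult_ne_0[of a \<sigma>] a1 \<sigma> by auto
  then have "((\<lambda>r. disk_moebius a (\<eta> r)) \<longlongrightarrow> disk_moebius a \<sigma>) (at_left 1)"
    unfolding Moebius_function_simple by (intro tendsto_intros lim)
  then have T\<sigma>: "disk_moebius a \<sigma> = u"
    using limu tendsto_unique trivial_limit_at_left_real by metis
  define k where "k = 1 - cmod a"
  have k: "0 < k"
    using a1 by (simp add: k_def)
  define N where "N = 4 * M / k\<^sup>2 * 2"
  have low: "k \<le> cmod (1 - cnj a * \<zeta>)" if "cmod \<zeta> \<le> 1" for \<zeta>
  proof -
    have "cmod a * cmod \<zeta> \<le> cmod a"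
      using that by (simp add: mult_left_le)
    then show ?thesis
      using norm_triangle_ineq2[of 1 "cnj a * \<zeta>"] by (simp add: k_def norm_mult)
  qed
  have N: "cmod (disk_moebius a w - u) \<le> N * (1 - cmod (disk_moebius a w))"
    if w: "w \<in> stolz_region \<sigma> M" for w
  proof -
    have w1: "cmod w < 1" and wM: "cmod (w - \<sigma>) \<le> M * (1 - cmod w)"
      using w by (auto simp: stolz_region_def norm_minus_commute)
    have "0 \<le> M * (1 - cmod w)"
      using wM norm_ge_zero order_trans by blast
    then have M0: "0 \<le> M"
      using w1 by (simp add: zero_le_mult_iff)
    have v1: "cmod (disk_moebius a w) < 1"
      using a1 w1 by (rule Moebius_function_norm_lt_1)
    have up: "cmod (1 - cnj a * w) \<le> 2"
    proof -
      have "cmod (1 - cnj a * w) \<le> 1 + cmod a * cmod w"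
        by (metis complex_mod_cnj norm_mult norm_one norm_triangle_ineq4)
      also have "\<dots> \<le> 2"
        using a1 w1 mult_le_one[of "cmod a" "cmod w"] by simp
      finally show ?thesis .
    qed
    have A: "cmod (1 - cnj a * a) = 1 - (cmod a)\<^sup>2"
    proof -
      have "1 - cnj a * a = of_real (1 - (cmod a)\<^sup>2)"
        using complex_norm_square[of a] by (simp add: mult.commute)
      then show ?thesis
        using one_minus_norm_sq_pos[OF a1] by (metis abs_of_pos norm_of_real)
    qed
    have "cmod (disk_moebius a w - u)
        = (1 - (cmod a)\<^sup>2) * cmod (w - \<sigma>) / (cmod (1 - cnj a * w) * cmod (1 - cnj a * \<sigma>))"
      using disk_moebius_diff[of a w \<sigma>] a1 w1 \<sigma> T\<sigma> by (simp add: norm_mult norm_divide A)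
    also have "\<dots> \<le> (1 - (cmod a)\<^sup>2) * (M * (1 - cmod w)) / (k * k)"
      using low[of w] low[of \<sigma>] w1 \<sigma> k wM one_minus_norm_sq_pos[OF a1] M0
      by (intro frac_le mult_mono mult_nonneg_nonneg) auto
    also have "\<dots> = 4 * M / k\<^sup>2 * ((1 - (cmod a)\<^sup>2) * (1 - cmod w) / 2\<^sup>2)"
      using k by (simp add: field_simps power2_eq_square)
    also have "(1 - (cmod a)\<^sup>2) * (1 - cmod w) / 2\<^sup>2
        \<le> (1 - (cmod a)\<^sup>2) * (1 - (cmod w)\<^sup>2) / (cmod (1 - cnj a * w))\<^sup>2"
      using up low[of w] w1 one_minus_norm_sq_pos[OF a1] less_le_trans[OF k low[of w]]
      by (intro frac_le mult_mono power_mono) (auto simp: power2_eq_square mult_left_le mult_le_one)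
    also have "\<dots> = 1 - (cmod (disk_moebius a w))\<^sup>2"
      unfolding norm_disk_moebius using one_minus_pseudo_dist_sq[OF a1 w1] by simp
    also have "\<dots> = (1 + cmod (disk_moebius a w)) * (1 - cmod (disk_moebius a w))"
      by (simp add: power2_eq_square algebra_simps)
    also have "\<dots> \<le> 2 * (1 - cmod (disk_moebius a w))"
      using v1 by (intro mult_right_mono) auto
    finally have "cmod (disk_moebius a w - u)
        \<le> 4 * M / k\<^sup>2 * (2 * (1 - cmod (disk_moebius a w)))"
      using M0 by (simp add: divide_right_mono mult_left_mono)
    then show ?thesis
      by (simp only: N_def mult.assoc)
  qed
  show thesis
  proof
    fix w assume w: "w \<in> stolz_region \<sigma> M"
    then have w1: "cmod w < 1"
      by (simp add: stolz_region_def)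
    define v where "v = disk_moebius a w"
    have v1: "cmod v < 1"
      unfolding v_def using a1 w1 by (rule Moebius_function_norm_lt_1)
    have vN: "cmod (v - u) \<le> N * (1 - cmod v)"
      using N[OF w] by (simp add: v_def)
    then have "0 \<le> N * (1 - cmod v)"
      using norm_ge_zero order_trans by blast
    then have N0: "0 \<le> N"
      using v1 by (simp add: zero_le_mult_iff)
    have "-1 < cmod v"
      using norm_ge_zero[of v] by linarith
    then have "cmod v \<in> {-1<..<1}"
      using v1 by simp
    then obtain r where r: "r \<in> {-1<..<1}" "disk_moebius a (\<eta> r) = of_real (cmod v) * u"
      using im by (metis (no_types, lifting) image_iff)
    have "pseudo_dist w (\<eta> r) = pseudo_dist v (of_real (cmod v) * u)"
      using pseudo_dist_disk_moebius[OF a1 w1 \<eta>1[OF r(1)]] r(2) by (simp add: v_def)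
    also have "\<dots> \<le> sqrt (1 - 1 / (N + 3)\<^sup>2)"
      using pseudo_dist_radial_projection_le[OF v1 u vN] .
    finally have "hyp_dist w (\<eta> r) \<le> artanh (sqrt (1 - 1 / (N + 3)\<^sup>2))"
      unfolding hyp_dist_eq_artanh using pseudo_dist_nonneg[of w "\<eta> r"] N0
      by (intro artanh_real_mono) auto
    then show "dist_to_geodesic w \<eta> \<le> artanh (sqrt (1 - 1 / (N + 3)\<^sup>2))"
      using dist_to_geodesic_le[OF \<eta> w1 r(1)] by linarith
  qed
qed


section \<open>Semigroups and their backward orbits\<close>

lemma disk_semigroup_holomorphic: "disk_semigroup \<phi> \<Longrightarrow> 0 \<le> t \<Longrightarrow> \<phi> t holomorphic_on unit_disk"
  by (simp add: disk_semigroup_def)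

lemma disk_semigroup_maps_to: "disk_semigroup \<phi> \<Longrightarrow> 0 \<le> t \<Longrightarrow> cmod z < 1 \<Longrightarrow> cmod (\<phi> t z) < 1"
  unfolding disk_semigroup_def image_subset_iff by simp

lemma disk_semigroup_0: "disk_semigroup \<phi> \<Longrightarrow> cmod z < 1 \<Longrightarrow> \<phi> 0 z = z"
  by (simp add: disk_semigroup_def)

lemma disk_semigroup_add:
  "disk_semigroup \<phi> \<Longrightarrow> 0 \<le> t \<Longrightarrow> 0 \<le> s \<Longrightarrow> cmod z < 1 \<Longrightarrow> \<phi> (t + s) z = \<phi> t (\<phi> s z)"
  by (simp add: disk_semigroup_def)

lemma disk_semigroup_tendsto_id:
  assumes "disk_semigroup \<phi>" "cmod z < 1"
  shows "((\<lambda>t. \<phi> t z) \<longlongrightarrow> z) (at_right 0)"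
proof -
  have "\<forall>K. compact K \<and> K \<subseteq> unit_disk \<longrightarrow> uniform_limit K \<phi> (\<lambda>z. z) (at_right 0)"
    using assms(1) unfolding disk_semigroup_def by blast
  then have "compact {z} \<and> {z} \<subseteq> unit_disk \<longrightarrow> uniform_limit {z} \<phi> (\<lambda>z. z) (at_right 0)"
    by (rule spec)
  then show ?thesis
    using assms(2) by simp
qed

text \<open>Continuity at \<open>0\<close> propagates to all times, from the left as well as from the right, because
  \<open>\<phi>\<^sub>a\<close> does not increase the pseudo-hyperbolic distance of \<open>\<phi>\<^sub>s(z)\<close> to \<open>z\<close>.\<close>
lemma disk_semigroup_continuous_time:
  assumes \<phi>: "disk_semigroup \<phi>" and z: "cmod z < 1"
  shows "continuous_on {0..} (\<lambda>t. \<phi> t z)"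
proof -
  have step: "cmod (\<phi> (a + s) z - \<phi> a z) \<le> 2 * pseudo_dist (\<phi> s z) z" if "0 \<le> a" "0 \<le> s" for a s
  proof -
    have 1: "cmod (\<phi> s z) < 1" "cmod (\<phi> (a + s) z) < 1" "cmod (\<phi> a z) < 1"
      using disk_semigroup_maps_to[OF \<phi>] z that by simp_all
    have "\<phi> a ` unit_disk \<subseteq> unit_disk"
      using \<phi> that by (simp add: disk_semigroup_def)
    then have "pseudo_dist (\<phi> a (\<phi> s z)) (\<phi> a z) \<le> pseudo_dist (\<phi> s z) z"
      using disk_semigroup_holomorphic[OF \<phi> that(1)] 1(1) z by (intro Schwarz_Pick)
    then show ?thesis
      using norm_diff_le_pseudo_dist[OF 1(2,3)] disk_semigroup_add[OF \<phi> that z] by simp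
  qed
  have "1 - cnj z * z \<noteq> 0"
    using one_minus_cnj_mult_ne_0[of z z] z by auto
  then have "((\<lambda>s. 2 * cmod ((\<phi> s z - z) / (1 - cnj (\<phi> s z) * z)))
      \<longlongrightarrow> 2 * cmod ((z - z) / (1 - cnj z * z))) (at_right 0)"
    by (intro tendsto_intros disk_semigroup_tendsto_id[OF \<phi> z])
  then have lim: "((\<lambda>s. 2 * pseudo_dist (\<phi> s z) z) \<longlongrightarrow> 0) (at_right 0)"
    by (simp add: pseudo_dist_def)
  show ?thesis
    unfolding continuous_on_iff
  proof (intro ballI allI impI)
    fix a e :: real assume a: "a \<in> {0..}" and e: "0 < e"
    have "eventually (\<lambda>s. 2 * pseudo_dist (\<phi> s z) z < e) (at_right 0)"
      using lim e by (rule order_tendstoD(2))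
    then obtain \<delta> where \<delta>: "0 < \<delta>" "\<And>s. 0 < s \<Longrightarrow> s < \<delta> \<Longrightarrow> 2 * pseudo_dist (\<phi> s z) z < e"
      unfolding eventually_at_right_field by auto
    have "dist (\<phi> b z) (\<phi> a z) < e" if b: "b \<in> {0..}" "dist b a < \<delta>" for b
    proof (cases b a rule: linorder_cases)
      case less
      then show ?thesis
        using step[of b "a - b"] \<delta>(2)[of "a - b"] b by (simp add: dist_norm norm_minus_commute)
    next
      case equal
      then show ?thesis
        using e by simp
    next
      case greater
      then show ?thesis
        using step[of a "b - a"] \<delta>(2)[of "b - a"] a b by (simp add: dist_norm)
    qed
    then show "\<exists>\<delta>>0. \<forall>b\<in>{0..}. dist b a < \<delta> \<longrightarrow> dist (\<phi> b z) (\<phi> a z) < e"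
      using \<delta>(1) by auto
  qed
qed

text \<open>By Cauchy's inequality \<open>f - id\<close> has derivative at most \<open>1/2\<close> on the smaller disk, hence is a
  strict contraction there.\<close>
lemma inj_on_ball_near_identity:
  assumes f: "f holomorphic_on cball \<zeta> (2 * r)" and r: "0 < r"
    and near: "\<And>z. z \<in> cball \<zeta> (2 * r) \<Longrightarrow> cmod (f z - z) \<le> r / 2"
  shows "inj_on f (ball \<zeta> r)"
proof -
  define g where "g = (\<lambda>z. f z - z)"
  have g: "g holomorphic_on cball \<zeta> (2 * r)"
    unfolding g_def by (intro holomorphic_intros f)
  have sub: "cball a r \<subseteq> cball \<zeta> (2 * r)" if "a \<in> ball \<zeta> r" for a
  proof
    fix b assume "b \<in> cball a r"
    then show "b \<in> cball \<zeta> (2 * r)"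
      using that dist_triangle[of \<zeta> b a] by simp
  qed
  have deriv: "cmod (deriv g a) \<le> 1/2" if a: "a \<in> ball \<zeta> r" for a
  proof -
    have "cmod ((deriv ^^ 1) g a) \<le> fact 1 * (r / 2) / r ^ 1"
    proof (rule Cauchy_inequality)
      have "g holomorphic_on cball a r"
        using g sub[OF a] by (rule holomorphic_on_subset)
      then show "g holomorphic_on ball a r" "continuous_on (cball a r) g"
        using holomorphic_on_subset ball_subset_cball holomorphic_on_imp_continuous_on by blast+
      show "cmod (g x) \<le> r / 2" if "cmod (a - x) = r" for x
        unfolding g_def using sub[OF a] that by (intro near) (auto simp: dist_norm subset_iff)
    qed (fact r)
    then show ?thesis
      using r by simp
  qed
  have lip: "cmod (g a - g b) \<le> 1/2 * cmod (a - b)" if "a \<in> ball \<zeta> r" "b \<in> ball \<zeta> r" for a b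
  proof (rule field_differentiable_bound[OF convex_ball _ deriv])
    fix x assume x: "x \<in> ball \<zeta> r"
    have "g holomorphic_on ball \<zeta> r"
      using g by (rule holomorphic_on_subset) (use r in auto)
    then show "(g has_field_derivative deriv g x) (at x within ball \<zeta> r)"
      by (rule has_field_derivative_at_within[OF holomorphic_derivI[OF _ open_ball x]])
  qed (use that in auto)
  show ?thesis
  proof (rule inj_onI)
    fix a b assume ab: "a \<in> ball \<zeta> r" "b \<in> ball \<zeta> r" "f a = f b"
    have "cmod (g a - g b) = cmod (a - b)"
      using ab(3) by (simp add: g_def norm_minus_commute)
    then show "a = b"
      using lip[OF ab(1,2)] by simp
  qed
qed

text \<open>If two orbits meet, consider the first time \<open>m\<close> at which they do. Just before \<open>m\<close> the two points
  are distinct and close to the meeting point, and a map \<open>\<phi>\<^sub>\<epsilon>\<close> with small \<open>\<epsilon>\<close> would identify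
  them; but such maps are close to the identity and therefore injective near the meeting point.\<close>
lemma disk_semigroup_inj_on:
  assumes \<phi>: "disk_semigroup \<phi>" and t: "0 \<le> t"
  shows "inj_on (\<phi> t) unit_disk"
proof (rule inj_onI, rule ccontr)
  fix z1 z2 assume z: "z1 \<in> unit_disk" "z2 \<in> unit_disk" and eq: "\<phi> t z1 = \<phi> t z2" and ne: "z1 \<noteq> z2"
  have z': "cmod z1 < 1" "cmod z2 < 1"
    using z by auto
  have cont: "continuous_on {0..} (\<lambda>s. \<phi> s z1)" "continuous_on {0..} (\<lambda>s. \<phi> s z2)"
    using disk_semigroup_continuous_time[OF \<phi>] z' by auto
  define S where "S = {s \<in> {0..t}. \<phi> s z1 = \<phi> s z2}"
  have S': "S = {s \<in> {0..t}. \<phi> s z1 - \<phi> s z2 = 0}"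
    by (simp add: S_def)
  have "continuous_on {0..t} (\<lambda>s. \<phi> s z1 - \<phi> s z2)"
    using cont by (intro continuous_on_diff) (auto intro: continuous_on_subset)
  then have "closed S"
    unfolding S' by (intro continuous_closed_preimage_constant) auto
  moreover have "S \<noteq> {}"
    using eq t by (auto simp: S_def)
  moreover have "bdd_below S"
    by (rule bdd_belowI[of _ 0]) (simp add: S_def)
  ultimately have mS: "Inf S \<in> S"
    using closed_contains_Inf by blast
  define m where "m = Inf S"
  have m: "0 \<le> m" "m \<le> t" "\<phi> m z1 = \<phi> m z2"
    using mS by (auto simp: S_def m_def)
  have least: "\<phi> s z1 \<noteq> \<phi> s z2" if "0 \<le> s" "s < m" for s
  proof
    assume "\<phi> s z1 = \<phi> s z2"
    then have "s \<in> S"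
      using that m by (simp add: S_def)
    then show False
      using cInf_lower[of s S] \<open>bdd_below S\<close> that by (simp add: m_def)
  qed
  have "m \<noteq> 0"
    using m(3) ne disk_semigroup_0[OF \<phi>] z' by auto
  then have m0: "0 < m"
    using m by simp
  define \<zeta> where "\<zeta> = \<phi> m z1"
  have "cmod \<zeta> < 1"
    unfolding \<zeta>_def using disk_semigroup_maps_to[OF \<phi> m(1) z'(1)] .
  define r where "r = (1 - cmod \<zeta>) / 4"
  have r: "0 < r"
    using \<open>cmod \<zeta> < 1\<close> by (simp add: r_def)
  have sub: "cball \<zeta> (2 * r) \<subseteq> unit_disk"
  proof
    fix b assume "b \<in> cball \<zeta> (2 * r)"
    then have "cmod (b - \<zeta>) \<le> 2 * r"
      by (simp add: dist_norm norm_minus_commute)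
    then show "b \<in> unit_disk"
      using norm_triangle_sub[of b \<zeta>] \<open>cmod \<zeta> < 1\<close> by (simp add: r_def)
  qed
  have "uniform_limit (cball \<zeta> (2 * r)) \<phi> (\<lambda>z. z) (at_right 0)"
    using \<phi> sub unfolding disk_semigroup_def by simp
  then have "eventually (\<lambda>\<epsilon>. \<forall>z\<in>cball \<zeta> (2 * r). dist (\<phi> \<epsilon> z) z < r / 2) (at_right 0)"
    using r by (intro uniform_limitD) auto
  then obtain e where e: "0 < e"
    "\<And>\<epsilon> z. 0 < \<epsilon> \<Longrightarrow> \<epsilon> < e \<Longrightarrow> z \<in> cball \<zeta> (2 * r) \<Longrightarrow> dist (\<phi> \<epsilon> z) z < r / 2"
    unfolding eventually_at_right_field by auto
  have inj: "inj_on (\<phi> \<epsilon>) (ball \<zeta> r)" if "0 < \<epsilon>" "\<epsilon> < e" for \<epsilon>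
  proof (rule inj_on_ball_near_identity[OF _ r])
    show "\<phi> \<epsilon> holomorphic_on cball \<zeta> (2 * r)"
      using disk_semigroup_holomorphic[OF \<phi> less_imp_le[OF that(1)]] sub
      by (rule holomorphic_on_subset)
    show "cmod (\<phi> \<epsilon> z - z) \<le> r / 2" if "z \<in> cball \<zeta> (2 * r)" for z
      using e(2)[OF \<open>0 < \<epsilon>\<close> \<open>\<epsilon> < e\<close> that] by (simp add: dist_norm)
  qed
  have lim: "((\<lambda>s. \<phi> s z1) \<longlongrightarrow> \<zeta>) (at m within {0..})" "((\<lambda>s. \<phi> s z2) \<longlongrightarrow> \<zeta>) (at m within {0..})"
    using cont(1)[unfolded continuous_on_def, rule_format, of m]
      cont(2)[unfolded continuous_on_def, rule_format, of m] m(1) unfolding \<zeta>_def m(3) by simp_all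
  have "eventually (\<lambda>s. dist (\<phi> s z1) \<zeta> < r \<and> dist (\<phi> s z2) \<zeta> < r) (at m within {0..})"
    using tendstoD[OF lim(1) r] tendstoD[OF lim(2) r] by (rule eventually_conj)
  then obtain d where d: "0 < d"
    "\<And>s. 0 \<le> s \<Longrightarrow> s \<noteq> m \<Longrightarrow> dist s m < d \<Longrightarrow> dist (\<phi> s z1) \<zeta> < r \<and> dist (\<phi> s z2) \<zeta> < r"
    unfolding eventually_at by auto
  define \<epsilon> where "\<epsilon> = min m (min (d / 2) (e / 2))"
  have \<epsilon>: "0 < \<epsilon>" "\<epsilon> \<le> m" "\<epsilon> < d" "\<epsilon> < e"
    using m0 d(1) e(1) by (auto simp: \<epsilon>_def min_def)
  have "dist (\<phi> (m - \<epsilon>) z1) \<zeta> < r \<and> dist (\<phi> (m - \<epsilon>) z2) \<zeta> < r"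
    using \<epsilon> by (intro d(2)) (auto simp: dist_real_def)
  then have in_ball: "\<phi> (m - \<epsilon>) z1 \<in> ball \<zeta> r" "\<phi> (m - \<epsilon>) z2 \<in> ball \<zeta> r"
    by (auto simp: dist_commute)
  have "\<phi> \<epsilon> (\<phi> (m - \<epsilon>) z1) = \<phi> \<epsilon> (\<phi> (m - \<epsilon>) z2)"
    using disk_semigroup_add[OF \<phi>, of \<epsilon> "m - \<epsilon>"] \<epsilon> z' m(3) by simp
  then have "\<phi> (m - \<epsilon>) z1 = \<phi> (m - \<epsilon>) z2"
    using inj_onD[OF inj[OF \<epsilon>(1,4)]] in_ball by blast
  then show False
    using least[of "m - \<epsilon>"] \<epsilon> by simp
qed

lemma backward_invariant_set_subset_disk:
  assumes "disk_semigroup \<phi>"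
  shows "backward_invariant_set \<phi> \<subseteq> unit_disk"
proof -
  have "backward_invariant_set \<phi> \<subseteq> \<phi> 0 ` unit_disk"
    by (auto simp: backward_invariant_set_def)
  also have "\<dots> \<subseteq> unit_disk"
    using assms by (simp add: disk_semigroup_def)
  finally show ?thesis .
qed

lemma backward_invariant_set_forward:
  assumes \<phi>: "disk_semigroup \<phi>" and s: "0 \<le> s" and z: "z \<in> backward_invariant_set \<phi>"
  shows "\<phi> s z \<in> backward_invariant_set \<phi>"
  unfolding backward_invariant_set_def
proof (rule INT_I)
  fix t :: real assume t: "t \<in> {0..}"
  then have "z \<in> \<phi> t ` unit_disk"
    using z unfolding backward_invariant_set_def by blast
  then obtain y where y: "cmod y < 1" "z = \<phi> t y"
    by auto
  have "\<phi> s z = \<phi> t (\<phi> s y)"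
    using disk_semigroup_add[OF \<phi> s, of t y] disk_semigroup_add[OF \<phi>, of t s y] s t y
    by (simp add: add.commute)
  then show "\<phi> s z \<in> \<phi> t ` unit_disk"
    using disk_semigroup_maps_to[OF \<phi> s y(1)] by auto
qed

lemma backward_invariant_set_backward:
  assumes \<phi>: "disk_semigroup \<phi>" and s: "0 \<le> s" and w: "cmod w < 1"
    and sw: "\<phi> s w \<in> backward_invariant_set \<phi>"
  shows "w \<in> backward_invariant_set \<phi>"
  unfolding backward_invariant_set_def
proof (rule INT_I)
  fix t :: real assume t: "t \<in> {0..}"
  then have "\<phi> s w \<in> \<phi> (s + t) ` unit_disk"
    using sw s unfolding backward_invariant_set_def by auto
  then obtain y where y: "cmod y < 1" "\<phi> s w = \<phi> (s + t) y"
    by auto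
  then have "\<phi> s w = \<phi> s (\<phi> t y)"
    using disk_semigroup_add[OF \<phi> s, of t y] t by simp
  then have "w = \<phi> t y"
    using inj_onD[OF disk_semigroup_inj_on[OF \<phi> s]] w disk_semigroup_maps_to[OF \<phi>, of t y] t y(1)
    by simp
  then show "w \<in> \<phi> t ` unit_disk"
    using y(1) by simp
qed

lemma interior_backward_invariant_set_forward:
  assumes \<phi>: "disk_semigroup \<phi>" and s: "0 \<le> s" and z: "z \<in> interior (backward_invariant_set \<phi>)"
  shows "\<phi> s z \<in> interior (backward_invariant_set \<phi>)"
proof -
  let ?I = "interior (backward_invariant_set \<phi>)"
  have sub: "?I \<subseteq> unit_disk"
    using backward_invariant_set_subset_disk[OF \<phi>] interior_subset by blast
  have "open (\<phi> s ` ?I)"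
    using disk_semigroup_holomorphic[OF \<phi> s] disk_semigroup_inj_on[OF \<phi> s] sub
    by (intro open_mapping_thm3 open_interior) (auto intro: holomorphic_on_subset inj_on_subset)
  moreover have "\<phi> s ` ?I \<subseteq> backward_invariant_set \<phi>"
    using backward_invariant_set_forward[OF \<phi> s] interior_subset by blast
  ultimately show ?thesis
    using z interior_maximal by blast
qed

lemma interior_backward_invariant_set_backward:
  assumes \<phi>: "disk_semigroup \<phi>" and s: "0 \<le> s" and w: "cmod w < 1"
    and sw: "\<phi> s w \<in> interior (backward_invariant_set \<phi>)"
  shows "w \<in> interior (backward_invariant_set \<phi>)"
proof (rule interiorI)
  let ?V = "unit_disk \<inter> \<phi> s -` interior (backward_invariant_set \<phi>)"
  show "open ?V"
    using disk_semigroup_holomorphic[OF \<phi> s]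
    by (intro continuous_open_preimage holomorphic_on_imp_continuous_on) auto
  show "w \<in> ?V"
    using w sw by simp
  show "?V \<subseteq> backward_invariant_set \<phi>"
    using backward_invariant_set_backward[OF \<phi> s] by (auto dest: interior_subset[THEN subsetD])
qed

lemma petal_subset_disk:
  assumes "disk_semigroup \<phi>" "petal \<phi> \<Delta>"
  shows "\<Delta> \<subseteq> unit_disk"
  using backward_invariant_set_subset_disk[OF assms(1)] assms(2) interior_subset in_components_subset
  unfolding petal_def by blast

text \<open>The preimage \<open>w\<close> of \<open>z\<close> lies in the interior of the backward invariant set, and so does the
  whole orbit from \<open>w\<close> to \<open>z\<close>, which is connected; hence \<open>w\<close> is in the same component as \<open>z\<close>.\<close>
lemma petal_backward_invariant:
  assumes \<phi>: "disk_semigroup \<phi>" and \<Delta>: "petal \<phi> \<Delta>" and z: "z \<in> \<Delta>" and s: "0 \<le> s"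
  obtains w where "w \<in> \<Delta>" "\<phi> s w = z"
proof -
  let ?I = "interior (backward_invariant_set \<phi>)"
  have \<Delta>c: "\<Delta> \<in> components ?I"
    using \<Delta> by (simp add: petal_def)
  have zI: "z \<in> ?I"
    using z \<Delta>c in_components_subset by blast
  then have "z \<in> \<phi> s ` unit_disk"
    using s interior_subset unfolding backward_invariant_set_def by blast
  then obtain w where w: "cmod w < 1" "\<phi> s w = z"
    by auto
  have wI: "w \<in> ?I"
    using interior_backward_invariant_set_backward[OF \<phi> s w(1)] w(2) zI by simp
  have "connected ((\<lambda>u. \<phi> u w) ` {0..s})"
    using disk_semigroup_continuous_time[OF \<phi> w(1)]
    by (intro connected_continuous_image) (auto intro: continuous_on_subset)
  moreover have "(\<lambda>u. \<phi> u w) ` {0..s} \<subseteq> ?I"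
    using interior_backward_invariant_set_forward[OF \<phi> _ wI] by auto
  moreover have "z \<in> (\<lambda>u. \<phi> u w) ` {0..s}"
    using w(2) s by (intro image_eqI[of _ _ s]) auto
  moreover have "w \<in> (\<lambda>u. \<phi> u w) ` {0..s}"
    using disk_semigroup_0[OF \<phi> w(1)] s by (intro image_eqI[of _ _ 0]) auto
  ultimately have "w \<in> \<Delta>"
    using components_maximal[OF \<Delta>c, of "(\<lambda>u. \<phi> u w) ` {0..s}"] z by blast
  then show thesis
    using w(2) that by blast
qed

lemma backward_orbit_in_petal:
  assumes "disk_semigroup \<phi>" "petal \<phi> \<Delta>" "z \<in> \<Delta>" "0 \<le> s"
  shows "backward_orbit \<phi> \<Delta> z (-s) \<in> \<Delta>" and "\<phi> s (backward_orbit \<phi> \<Delta> z (-s)) = z"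
proof -
  have "z \<in> \<phi> s ` \<Delta>"
    using petal_backward_invariant[OF assms] by (metis imageI)
  then show "backward_orbit \<phi> \<Delta> z (-s) \<in> \<Delta>" and "\<phi> s (backward_orbit \<phi> \<Delta> z (-s)) = z"
    unfolding backward_orbit_def by (auto simp: inv_into_into f_inv_into_f)
qed

lemma backward_orbit_in_disk:
  assumes "disk_semigroup \<phi>" "petal \<phi> \<Delta>" "z \<in> \<Delta>" "0 \<le> s"
  shows "cmod (backward_orbit \<phi> \<Delta> z (-s)) < 1"
  using backward_orbit_in_petal(1)[OF assms] petal_subset_disk[OF assms(1,2)] by auto

lemma backward_orbit_step:
  assumes \<phi>: "disk_semigroup \<phi>" and \<Delta>: "petal \<phi> \<Delta>" and z: "z \<in> \<Delta>" and su: "0 \<le> s" "0 \<le> u"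
  shows "\<phi> u (backward_orbit \<phi> \<Delta> z (-(s + u))) = backward_orbit \<phi> \<Delta> z (-s)"
proof -
  let ?w = "\<lambda>s. backward_orbit \<phi> \<Delta> z (-s)"
  have 1: "cmod (?w (s + u)) < 1" "cmod (?w s) < 1"
    using backward_orbit_in_disk[OF \<phi> \<Delta> z, of "s + u"] backward_orbit_in_disk[OF \<phi> \<Delta> z, of s] su
    by simp_all
  have "\<phi> s (\<phi> u (?w (s + u))) = \<phi> s (?w s)"
    using disk_semigroup_add[OF \<phi> su 1(1)] backward_orbit_in_petal(2)[OF \<phi> \<Delta> z, of "s + u"]
      backward_orbit_in_petal(2)[OF \<phi> \<Delta> z, of s] su by simp
  then show ?thesis
    using inj_onD[OF disk_semigroup_inj_on[OF \<phi> su(1)]] disk_semigroup_maps_to[OF \<phi> su(2) 1(1)] 1(2)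
    by simp
qed

text \<open>The inverse \<open>g\<close> of \<open>\<phi>\<^sub>s\<^sub>+\<^sub>u\<close> is defined on a disk around \<open>z\<close> whose radius is that of a disk
  inside the petal and so independent of \<open>s\<close> and \<open>u\<close>. It sends \<open>z\<close> and the nearby point \<open>\<phi>\<^sub>u(z)\<close> to the
  orbit points at times \<open>s + u\<close> and \<open>s\<close>, and it does not increase hyperbolic distances.\<close>
lemma backward_orbit_bounded_steps:
  assumes \<phi>: "disk_semigroup \<phi>" and \<Delta>: "petal \<phi> \<Delta>" and z: "z \<in> \<Delta>"
  obtains \<delta> where "0 < \<delta>"
    and "\<And>s u. 0 \<le> s \<Longrightarrow> 0 \<le> u \<Longrightarrow> u \<le> \<delta>
      \<Longrightarrow> pseudo_dist (backward_orbit \<phi> \<Delta> z (-(s + u))) (backward_orbit \<phi> \<Delta> z (-s)) \<le> 1/2"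
proof -
  let ?w = "\<lambda>s. backward_orbit \<phi> \<Delta> z (-s)"
  have z1: "cmod z < 1"
    using z petal_subset_disk[OF \<phi> \<Delta>] by auto
  have "open \<Delta>"
    using \<Delta> open_components open_interior unfolding petal_def by blast
  then obtain r where r: "0 < r" "ball z r \<subseteq> \<Delta>"
    using z open_contains_ball by blast
  have "eventually (\<lambda>u. dist (\<phi> u z) z < r / 2) (at_right 0)"
    using disk_semigroup_tendsto_id[OF \<phi> z1] r(1) by (intro tendstoD) auto
  then obtain e where e: "0 < e" "\<And>u. 0 < u \<Longrightarrow> u < e \<Longrightarrow> dist (\<phi> u z) z < r / 2"
    unfolding eventually_at_right_field by auto
  show thesis
  proof
    show "0 < e / 2"
      using e(1) by simp
    fix s u :: real assume su: "0 \<le> s" "0 \<le> u" "u \<le> e / 2"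
    have near: "dist (\<phi> u z) z < r / 2"
      using e(2)[of u] su e(1) r(1) disk_semigroup_0[OF \<phi> z1] by (cases "u = 0") auto
    have t: "0 \<le> s + u"
      using su by simp
    obtain g where g: "g holomorphic_on \<phi> (s + u) ` unit_disk"
      and g_inv: "\<And>y. y \<in> unit_disk \<Longrightarrow> g (\<phi> (s + u) y) = y"
      using holomorphic_has_inverse[OF disk_semigroup_holomorphic[OF \<phi> t] open_ball
          disk_semigroup_inj_on[OF \<phi> t]] by metis
    have sub: "ball z r \<subseteq> \<phi> (s + u) ` unit_disk"
    proof -
      have "\<Delta> \<subseteq> backward_invariant_set \<phi>"
        using \<Delta> in_components_subset interior_subset unfolding petal_def by blast
      also have "\<dots> \<subseteq> \<phi> (s + u) ` unit_disk"
        using t by (auto simp: backward_invariant_set_def)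
      finally show ?thesis
        using r(2) by blast
    qed
    have "pseudo_dist (g z) (g (\<phi> u z)) \<le> cmod (\<phi> u z - z) / r"
    proof (rule Schwarz_Pick_ball)
      show "g holomorphic_on ball z r"
        using g sub by (rule holomorphic_on_subset)
      show "g ` ball z r \<subseteq> unit_disk"
        using sub g_inv by (force simp: image_subset_iff)
      show "\<phi> u z \<in> ball z r"
        using near r(1) by (simp add: dist_commute)
    qed
    also have "\<dots> \<le> 1/2"
      using near r(1) by (simp add: dist_norm field_simps)
    also have "g z = ?w (s + u)"
      using g_inv[of "?w (s + u)"] backward_orbit_in_disk[OF \<phi> \<Delta> z t]
        backward_orbit_in_petal(2)[OF \<phi> \<Delta> z t] by simp
    also have "g (\<phi> u z) = ?w s"
    proof -
      have "\<phi> (s + u) (?w s) = \<phi> u z"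
        using disk_semigroup_add[OF \<phi> su(2,1) backward_orbit_in_disk[OF \<phi> \<Delta> z su(1)]]
          backward_orbit_in_petal(2)[OF \<phi> \<Delta> z su(1)] by (simp add: add.commute)
      then show ?thesis
        using g_inv[of "?w s"] backward_orbit_in_disk[OF \<phi> \<Delta> z su(1)] by simp
    qed
    finally show "pseudo_dist (?w (s + u)) (?w s) \<le> 1/2" .
  qed
qed


section \<open>Dilation at a boundary fixed point\<close>

lemma tendsto_le_frequently:
  fixes a b :: real
  assumes "(g \<longlongrightarrow> a) F" "(h \<longlongrightarrow> b) F" "frequently (\<lambda>x. g x \<le> h x) F"
  shows "a \<le> b"
proof (rule ccontr)
  assume "\<not> a \<le> b"
  then have "0 < a - b"
    by simp
  moreover have "((\<lambda>x. g x - h x) \<longlongrightarrow> a - b) F"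
    using assms by (intro tendsto_diff)
  ultimately have "eventually (\<lambda>x. 0 < g x - h x) F"
    by (rule order_tendstoD(1)[rotated])
  then have "eventually (\<lambda>x. \<not> g x \<le> h x) F"
    by eventually_elim simp
  then show False
    using assms(3) by (simp add: frequently_def)
qed

text \<open>Julia's lemma: let the first point in the Schwarz--Pick inequality tend to the boundary fixed
  point. The quotient \<open>(1 - |f w|) / (1 - |w|)\<close> survives in the limit as the factor \<open>c\<close>. It is enough
  that \<open>c\<close> bounds this quotient frequently, which is what arguments by contradiction provide.\<close>
lemma julia_inequality:
  fixes w :: "'a \<Rightarrow> complex"
  assumes f: "f holomorphic_on unit_disk" "f ` unit_disk \<subseteq> unit_disk"
    and \<sigma>: "cmod \<sigma> = 1" and w: "(w \<longlongrightarrow> \<sigma>) F" and fw: "((\<lambda>x. f (w x)) \<longlongrightarrow> \<sigma>) F"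
    and freq: "frequently (\<lambda>x. cmod (w x) < 1 \<and> 1 - cmod (f (w x)) \<le> c * (1 - cmod (w x))) F"
    and z: "cmod z < 1"
  shows "(1 - (cmod z)\<^sup>2) / (cmod (1 - cnj \<sigma> * z))\<^sup>2
    \<le> c * (1 - (cmod (f z))\<^sup>2) / (cmod (1 - cnj \<sigma> * f z))\<^sup>2"
proof -
  have f1: "cmod (f b) < 1" if "cmod b < 1" for b
    using f(2) that by (auto simp: image_subset_iff)
  \<comment> \<open>The quotient \<open>(1 - pseudo_dist\<^sup>2) / (1 - |a|)\<close>, which stays finite as \<open>a\<close> tends to the circle.\<close>
  define G where "G = (\<lambda>a b. (1 + cmod a) * (1 - (cmod b)\<^sup>2) / (cmod (1 - cnj a * b))\<^sup>2)"
  have G_lim: "((\<lambda>x. G (v x) b) \<longlongrightarrow> G \<sigma> b) F" if "(v \<longlongrightarrow> \<sigma>) F" "cmod b < 1" for v :: "'a \<Rightarrow> complex" and b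
    unfolding G_def using that \<sigma> one_minus_cnj_mult_ne_0[of \<sigma> b] by (intro tendsto_intros) auto
  have "G \<sigma> z \<le> c * G \<sigma> (f z)"
  proof (rule tendsto_le_frequently)
    show "((\<lambda>x. G (w x) z) \<longlongrightarrow> G \<sigma> z) F"
      using w z by (rule G_lim)
    show "((\<lambda>x. c * G (f (w x)) (f z)) \<longlongrightarrow> c * G \<sigma> (f z)) F"
      using G_lim[OF fw f1[OF z]] by (intro tendsto_intros)
    show "frequently (\<lambda>x. G (w x) z \<le> c * G (f (w x)) (f z)) F"
      using freq
    proof (rule frequently_elim1)
      fix x assume x: "cmod (w x) < 1 \<and> 1 - cmod (f (w x)) \<le> c * (1 - cmod (w x))"
      define a where "a = w x"
      have a: "cmod a < 1" "1 - cmod (f a) \<le> c * (1 - cmod a)"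
        using x by (auto simp: a_def)
      have "pseudo_dist (f a) (f z) \<le> pseudo_dist a z"
        using Schwarz_Pick[OF f a(1) z] .
      then have "(pseudo_dist (f a) (f z))\<^sup>2 \<le> (pseudo_dist a z)\<^sup>2"
        using pseudo_dist_nonneg by (intro power_mono) auto
      then have "1 - (pseudo_dist a z)\<^sup>2 \<le> 1 - (pseudo_dist (f a) (f z))\<^sup>2"
        by simp
      moreover have "1 - (pseudo_dist a z)\<^sup>2 = (1 - cmod a) * G a z"
        unfolding one_minus_pseudo_dist_sq[OF a(1) z] G_def
        by (simp add: power2_eq_square[of "cmod a"] algebra_simps)
      moreover have "1 - (pseudo_dist (f a) (f z))\<^sup>2 = (1 - cmod (f a)) * G (f a) (f z)"
        unfolding one_minus_pseudo_dist_sq[OF f1[OF a(1)] f1[OF z]] G_def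
        by (simp add: power2_eq_square[of "cmod (f a)"] algebra_simps)
      moreover have "(1 - cmod (f a)) * G (f a) (f z) \<le> (c * (1 - cmod a)) * G (f a) (f z)"
        using a(2) one_minus_norm_sq_pos[OF f1[OF z]] unfolding G_def
        by (intro mult_right_mono divide_nonneg_nonneg mult_nonneg_nonneg) auto
      ultimately have "(1 - cmod a) * G a z \<le> (1 - cmod a) * (c * G (f a) (f z))"
        by (simp add: mult_ac)
      then show "G (w x) z \<le> c * G (f (w x)) (f z)"
        using a(1) unfolding a_def[symmetric] by (subst (asm) mult_le_cancel_left_pos) auto
    qed
  qed
  moreover have "G \<sigma> b = 2 * ((1 - (cmod b)\<^sup>2) / (cmod (1 - cnj \<sigma> * b))\<^sup>2)" for b
    unfolding G_def \<sigma> by (simp only: one_add_one times_divide_eq_right)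
  ultimately show ?thesis
    by (simp only: mult.left_commute[of c 2] mult_le_cancel_left_pos[OF zero_less_numeral]
        times_divide_eq_right)
qed

text \<open>The part of the Julia--Wolff--Caratheodory theorem that is valid for unrestricted approach: if
  the dilation quotient were frequently below \<open>c < A\<close>, then Julia's inequality at the points
  \<open>r \<sigma>\<close> of the radius would bound the radial difference quotients by \<open>2 c / (1 + r)\<close>, and their limit
  \<open>A\<close> by \<open>c\<close>.\<close>
lemma boundary_dilation_ge_angular_derivative:
  fixes w :: "'a \<Rightarrow> complex"
  assumes f: "f holomorphic_on unit_disk" "f ` unit_disk \<subseteq> unit_disk"
    and \<sigma>: "cmod \<sigma> = 1" and w: "(w \<longlongrightarrow> \<sigma>) F" and fw: "((\<lambda>x. f (w x)) \<longlongrightarrow> \<sigma>) F"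
    and w1: "eventually (\<lambda>x. cmod (w x) < 1) F"
    and deriv: "has_angular_derivative_at_fixed f \<sigma> (of_real A)" and c: "c < A"
  shows "eventually (\<lambda>x. c * (1 - cmod (w x)) \<le> 1 - cmod (f (w x))) F"
proof (rule ccontr)
  assume "\<not> ?thesis"
  then have "frequently (\<lambda>x. \<not> c * (1 - cmod (w x)) \<le> 1 - cmod (f (w x))) F"
    by (simp add: not_eventually)
  then have freq: "frequently (\<lambda>x. cmod (w x) < 1 \<and> 1 - cmod (f (w x)) \<le> c * (1 - cmod (w x))) F"
    by (rule frequently_rev_mp) (use w1 in eventually_elim, auto)
  have unit: "cnj \<sigma> * \<sigma> = 1"
    using complex_norm_square[of \<sigma>] \<sigma> by (simp add: mult.commute)
  have bound: "cmod ((f (of_real r * \<sigma>) - \<sigma>) / (of_real r * \<sigma> - \<sigma>)) \<le> 2 * c / (1 + r)"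
    if r: "0 < r" "r < 1" for r
  proof -
    define z where "z = of_real r * \<sigma>"
    have z: "cmod z = r"
      using r \<sigma> by (simp add: z_def norm_mult)
    have f1: "cmod (f z) < 1"
      using f(2) z r by (auto simp: image_subset_iff)
    have "1 - cnj \<sigma> * z = of_real (1 - r)"
      using unit by (simp add: z_def mult.left_commute)
    then have n1: "cmod (1 - cnj \<sigma> * z) = 1 - r"
      using r by (metis abs_of_nonneg diff_ge_0_iff_ge less_imp_le norm_of_real)
    have "z - \<sigma> = - of_real (1 - r) * \<sigma>"
      by (simp add: z_def algebra_simps)
    then have n2: "cmod (z - \<sigma>) = 1 - r"
      using r \<sigma> by (simp add: norm_mult del: of_real_diff)
    define D where "D = cmod (f z - \<sigma>)"
    have "1 - cnj \<sigma> * f z = cnj \<sigma> * (\<sigma> - f z)"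
      using unit by (simp add: algebra_simps)
    then have n3: "cmod (1 - cnj \<sigma> * f z) = D"
      using \<sigma> by (simp add: norm_mult D_def norm_minus_commute)
    have D: "1 - cmod (f z) \<le> D"
      using norm_triangle_ineq3[of \<sigma> "f z"] \<sigma> by (simp add: D_def norm_minus_commute)
    then have D0: "0 < D"
      using f1 by simp
    have J: "(1 - r\<^sup>2) / (1 - r)\<^sup>2 \<le> c * (1 - (cmod (f z))\<^sup>2) / D\<^sup>2"
      using julia_inequality[OF f \<sigma> w fw freq, of z] z r by (simp add: n1 n3)
    have "1 - r\<^sup>2 = (1 - r) * (1 + r)"
      by (simp add: power2_eq_square algebra_simps)
    then have L: "(1 - r\<^sup>2) / (1 - r)\<^sup>2 = (1 + r) / (1 - r)"
      using r by (simp only: power2_eq_square[of "1 - r"]) simp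
    have "0 < (1 + r) / (1 - r)"
      using r by simp
    then have "0 < c * ((1 - (cmod (f z))\<^sup>2) / D\<^sup>2)"
      using J L by simp
    then have c0: "0 < c"
      using one_minus_norm_sq_pos[OF f1] D0 by (simp add: zero_less_mult_iff zero_less_divide_iff)
    have "1 - (cmod (f z))\<^sup>2 = (1 + cmod (f z)) * (1 - cmod (f z))"
      by (simp add: power2_eq_square algebra_simps)
    also have "\<dots> \<le> 2 * D"
      using f1 D by (intro mult_mono) auto
    finally have "c * (1 - (cmod (f z))\<^sup>2) / D\<^sup>2 \<le> c * (2 * D) / D\<^sup>2"
      using c0 by (intro divide_right_mono mult_left_mono) auto
    moreover have "c * (2 * D) / D\<^sup>2 = 2 * c / D"
      using D0 by (simp add: power2_eq_square)
    ultimately have "(1 + r) / (1 - r) \<le> 2 * c / D"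
      using J L by linarith
    then have "D / (1 - r) \<le> 2 * c / (1 + r)"
      using r D0 by (simp add: field_simps)
    then show ?thesis
      using n2 by (simp add: norm_divide D_def z_def)
  qed
  have ev: "eventually (\<lambda>r. r \<in> {0<..<1}) (at_left (1::real))"
    by (rule eventually_at_leftI[of 0]) auto
  have radial: "filterlim (\<lambda>r. of_real r * \<sigma>) (at \<sigma> within stolz_region \<sigma> 2) (at_left 1)"
    unfolding filterlim_at
  proof
    have "((\<lambda>r. of_real r * \<sigma>) \<longlongrightarrow> of_real 1 * \<sigma>) (at_left 1)"
      by (intro tendsto_intros)
    then show "((\<lambda>r. of_real r * \<sigma>) \<longlongrightarrow> \<sigma>) (at_left 1)"
      by simp
    show "eventually (\<lambda>r. of_real r * \<sigma> \<in> stolz_region \<sigma> 2 \<and> of_real r * \<sigma> \<noteq> \<sigma>) (at_left 1)"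
      using ev
    proof eventually_elim
      case (elim r)
      have "\<sigma> - of_real r * \<sigma> = of_real (1 - r) * \<sigma>"
        by (simp add: algebra_simps)
      then have "cmod (\<sigma> - of_real r * \<sigma>) = 1 - r"
        using elim \<sigma> by (simp add: norm_mult del: of_real_diff)
      then show ?case
        using elim \<sigma> by (auto simp: stolz_region_def norm_mult)
    qed
  qed
  have "((\<lambda>z. (f z - \<sigma>) / (z - \<sigma>)) \<longlongrightarrow> of_real A) (at \<sigma> within stolz_region \<sigma> 2)"
    using deriv unfolding has_angular_derivative_at_fixed_def has_angular_limit_def by simp
  then have "((\<lambda>r. (f (of_real r * \<sigma>) - \<sigma>) / (of_real r * \<sigma> - \<sigma>)) \<longlongrightarrow> of_real A) (at_left 1)"
    using radial by (rule filterlim_compose)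
  then have "((\<lambda>r. cmod ((f (of_real r * \<sigma>) - \<sigma>) / (of_real r * \<sigma> - \<sigma>))) \<longlongrightarrow> \<bar>A\<bar>) (at_left 1)"
    using tendsto_norm by fastforce
  moreover have "((\<lambda>r. 2 * c / (1 + r)) \<longlongrightarrow> 2 * c / (1 + 1)) (at_left 1)"
    by (intro tendsto_intros) auto
  moreover have "eventually (\<lambda>r. cmod ((f (of_real r * \<sigma>) - \<sigma>) / (of_real r * \<sigma> - \<sigma>)) \<le> 2 * c / (1 + r)) (at_left 1)"
    using ev by eventually_elim (use bound in auto)
  ultimately have "\<bar>A\<bar> \<le> 2 * c / (1 + 1)"
    by (intro tendsto_le[OF trivial_limit_at_left_real])
  then show False
    using c by simp
qed


section \<open>Rates of escape along curves\<close>

lemma tendsto_ratio_of_bounded_diff: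
  fixes f g :: "real \<Rightarrow> real"
  assumes g: "((\<lambda>s. g s / s) \<longlongrightarrow> l) at_top"
    and B: "eventually (\<lambda>s. \<bar>f s - g s\<bar> \<le> B) at_top"
  shows "((\<lambda>s. f s / s) \<longlongrightarrow> l) at_top"
proof (rule Lim_transform[OF g])
  show "((\<lambda>s. f s / s - g s / s) \<longlongrightarrow> 0) at_top"
  proof (rule Lim_null_comparison)
    show "eventually (\<lambda>s. norm (f s / s - g s / s) \<le> B / s) at_top"
      using B eventually_gt_at_top[of 0]
    proof eventually_elim
      case (elim s)
      have "norm (f s / s - g s / s) = \<bar>f s - g s\<bar> / s"
        using elim by (simp add: diff_divide_distrib[symmetric])
      then show ?case
        using elim by (simp add: divide_right_mono)
    qed
    show "((\<lambda>s. B / s) \<longlongrightarrow> 0) at_top"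
      by real_asymp
  qed
qed

text \<open>A Cesaro argument in continuous time. After subtracting the linear function of slope \<open>l / \<delta>\<close>
  the increments tend to \<open>0\<close>; the bound on shorter increments takes care of the time left over after
  full steps of length \<open>\<delta>\<close>.\<close>
lemma linear_growth_of_convergent_increments:
  fixes q :: "real \<Rightarrow> real"
  assumes \<delta>: "0 < \<delta>" and inc: "((\<lambda>s. q (s + \<delta>) - q s) \<longlongrightarrow> l) at_top"
    and bdd: "\<And>s u. S \<le> s \<Longrightarrow> 0 \<le> u \<Longrightarrow> u \<le> \<delta> \<Longrightarrow> \<bar>q (s + u) - q s\<bar> \<le> C"
  shows "((\<lambda>s. q s / s) \<longlongrightarrow> l / \<delta>) at_top"
proof -
  define p where "p = (\<lambda>s. q s - l / \<delta> * s)"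
  have "((\<lambda>s. (q (s + \<delta>) - q s) - l) \<longlongrightarrow> l - l) at_top"
    by (intro tendsto_intros inc)
  then have p_inc: "((\<lambda>s. p (s + \<delta>) - p s) \<longlongrightarrow> 0) at_top"
    using \<delta> by (simp add: p_def algebra_simps add_divide_distrib)
  have p_bdd: "\<bar>p (s + u) - p s\<bar> \<le> C + \<bar>l\<bar>" if "S \<le> s" "0 \<le> u" "u \<le> \<delta>" for s u
  proof -
    have "p (s + u) - p s = (q (s + u) - q s) - l * (u / \<delta>)"
      by (simp add: p_def algebra_simps add_divide_distrib)
    then have "\<bar>p (s + u) - p s\<bar> \<le> \<bar>q (s + u) - q s\<bar> + \<bar>l\<bar> * (u / \<delta>)"
      using that \<delta> abs_triangle_ineq4[of "q (s + u) - q s" "l * (u / \<delta>)"] by (simp add: abs_mult)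
    moreover have "\<bar>l\<bar> * (u / \<delta>) \<le> \<bar>l\<bar> * 1"
      using that \<delta> by (intro mult_left_mono) auto
    ultimately show ?thesis
      using bdd[OF that] by simp
  qed
  have "((\<lambda>s. p s / s) \<longlongrightarrow> 0) at_top"
  proof (rule tendstoI)
    fix e :: real assume e: "0 < e"
    have "eventually (\<lambda>s. dist (p (s + \<delta>) - p s) 0 < e / 2 * \<delta>) at_top"
      using p_inc e \<delta> by (intro tendstoD) auto
    then obtain S0 where S0: "\<And>s. S0 \<le> s \<Longrightarrow> \<bar>p (s + \<delta>) - p s\<bar> < e / 2 * \<delta>"
      unfolding eventually_at_top_linorder by (auto simp: dist_real_def)
    define S1 where "S1 = max 0 (max S S0)"
    have S1: "0 \<le> S1" "S \<le> S1" "S0 \<le> S1"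
      by (auto simp: S1_def)
    have steps: "\<bar>p (S1 + real n * \<delta>) - p S1\<bar> \<le> e / 2 * (real n * \<delta>)" for n
    proof (induction n)
      case 0
      then show ?case by simp
    next
      case (Suc n)
      have "0 \<le> real n * \<delta>"
        using \<delta> by simp
      then have "\<bar>p (S1 + real n * \<delta> + \<delta>) - p (S1 + real n * \<delta>)\<bar> < e / 2 * \<delta>"
        using S1 by (intro S0) linarith
      moreover have eq: "S1 + real (Suc n) * \<delta> = S1 + real n * \<delta> + \<delta>"
        by (simp add: algebra_simps)
      moreover have "e / 2 * (real (Suc n) * \<delta>) = e / 2 * (real n * \<delta>) + e / 2 * \<delta>"
        by (simp add: algebra_simps)
      ultimately show ?case
        using Suc.IH unfolding eq by linarith
    qed
    have lin: "\<bar>p s\<bar> \<le> e / 2 * s + (C + \<bar>l\<bar> + \<bar>p S1\<bar>)" if s: "S1 \<le> s" for s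
    proof -
      define n where "n = nat \<lfloor>(s - S1) / \<delta>\<rfloor>"
      have "0 \<le> (s - S1) / \<delta>"
        using s \<delta> by simp
      then have n: "real n \<le> (s - S1) / \<delta>" "(s - S1) / \<delta> \<le> real n + 1"
        by (simp_all add: n_def)
      define u where "u = s - (S1 + real n * \<delta>)"
      have u: "0 \<le> u" "u \<le> \<delta>"
        using n \<delta> by (simp_all add: u_def field_simps)
      have n\<delta>: "0 \<le> real n * \<delta>"
        using \<delta> by simp
      have "S \<le> S1 + real n * \<delta>"
        using S1 n\<delta> by linarith
      then have "\<bar>p (S1 + real n * \<delta> + u) - p (S1 + real n * \<delta>)\<bar> \<le> C + \<bar>l\<bar>"
        using u by (rule p_bdd)
      moreover have us: "S1 + real n * \<delta> + u = s"
        by (simp add: u_def)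
      moreover have "e / 2 * (real n * \<delta>) \<le> e / 2 * s"
        using e u(1) S1 by (intro mult_left_mono) (auto simp: u_def)
      ultimately show ?thesis
        using steps[of n] unfolding us by linarith
    qed
    define B where "B = C + \<bar>l\<bar> + \<bar>p S1\<bar>"
    have "((\<lambda>s. B / s) \<longlongrightarrow> 0) at_top"
      by real_asymp
    then have "eventually (\<lambda>s. B / s < e / 2) at_top"
      using e by (intro order_tendstoD(2)) auto
    then show "eventually (\<lambda>s. dist (p s / s) 0 < e) at_top"
      using eventually_gt_at_top[of 0] eventually_ge_at_top[of S1]
    proof eventually_elim
      case (elim s)
      have "\<bar>p s\<bar> / s \<le> (e / 2 * s + B) / s"
        using lin[OF elim(3)] elim(2) by (intro divide_right_mono) (auto simp: B_def)
      also have "\<dots> = e / 2 + B / s"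
        using elim(2) by (simp add: add_divide_distrib)
      also have "\<dots> < e / 2 + e / 2"
        using elim(1) by (rule add_strict_left_mono)
      finally show ?case
        using elim(2) by simp
    qed
  qed
  then have "((\<lambda>s. p s / s + l / \<delta>) \<longlongrightarrow> 0 + l / \<delta>) at_top"
    by (intro tendsto_intros)
  moreover have "eventually (\<lambda>s. p s / s + l / \<delta> = q s / s) at_top"
    using eventually_gt_at_top[of 0]
    by eventually_elim (simp add: p_def diff_divide_distrib)
  ultimately show ?thesis
    using Lim_transform_eventually by fastforce
qed

section \<open>Backward orbits converging to a repelling fixed point\<close>

text \<open>A curve run backwards by a self-map \<open>f\<close> of the disk, with hyperbolically bounded steps,
  that converges to a repelling boundary fixed point of \<open>f\<close>. The map \<open>f\<close> stands for \<open>\<phi>\<^sub>\<delta>\<close>, and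
  \<open>\<alpha>\<close> for minus the repelling spectral value.\<close>
locale repelling_backward_orbit =
  fixes f :: "complex \<Rightarrow> complex" and w :: "real \<Rightarrow> complex" and \<sigma> :: complex and \<delta> \<alpha> :: real
  assumes f: "f holomorphic_on unit_disk" "f ` unit_disk \<subseteq> unit_disk"
    and \<sigma>: "cmod \<sigma> = 1" and \<delta>: "0 < \<delta>" and \<alpha>: "0 < \<alpha>"
    and deriv: "has_angular_derivative_at_fixed f \<sigma> (of_real (exp (\<alpha> * \<delta>)))"
    and w_disk: "\<And>s. 0 \<le> s \<Longrightarrow> cmod (w s) < 1"
    and w_lim: "(w \<longlongrightarrow> \<sigma>) at_top"
    and f_w: "\<And>s. 0 \<le> s \<Longrightarrow> f (w (s + \<delta>)) = w s"
    and steps: "\<And>s u. 0 \<le> s \<Longrightarrow> 0 \<le> u \<Longrightarrow> u \<le> \<delta> \<Longrightarrow> pseudo_dist (w (s + u)) (w s) \<le> 1/2"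
begin

lemma w_shift_lim: "((\<lambda>s. w (s + \<delta>)) \<longlongrightarrow> \<sigma>) at_top"
  by (rule filterlim_compose[OF w_lim]) real_asymp

text \<open>Since \<open>1 - |w s|\<close> shrinks by a factor \<open>1 / c\<close> in every step and bounds the length of the step
  up to the factor \<open>2\<close>, the distance left to \<open>\<sigma>\<close> is at most a geometric series with first term
  \<open>2 (1 - |w s|)\<close>.\<close>
lemma nontangential:
  obtains K S where "1 \<le> K" "0 \<le> S" "\<And>s. S \<le> s \<Longrightarrow> cmod (w s - \<sigma>) \<le> K * (1 - cmod (w s))"
proof -
  have "1 < exp (\<alpha> * \<delta>)"
    using \<alpha> \<delta> by simp
  then obtain c where c: "1 < c" "c < exp (\<alpha> * \<delta>)"
    using dense by blast
  have "eventually (\<lambda>s. w s = f (w (s + \<delta>))) at_top"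
    using eventually_ge_at_top[of 0] by eventually_elim (simp add: f_w)
  then have "((\<lambda>s. f (w (s + \<delta>))) \<longlongrightarrow> \<sigma>) at_top"
    by (rule Lim_transform_eventually[OF w_lim])
  moreover have "eventually (\<lambda>s. cmod (w (s + \<delta>)) < 1) at_top"
    using eventually_ge_at_top[of 0] by eventually_elim (use \<delta> in \<open>simp add: w_disk\<close>)
  ultimately have "eventually (\<lambda>s. c * (1 - cmod (w (s + \<delta>))) \<le> 1 - cmod (f (w (s + \<delta>)))) at_top"
    using f \<sigma> w_shift_lim deriv c(2) by (intro boundary_dilation_ge_angular_derivative[where A = "exp (\<alpha> * \<delta>)"])
  then obtain S0 where S0: "\<And>s. S0 \<le> s \<Longrightarrow> c * (1 - cmod (w (s + \<delta>))) \<le> 1 - cmod (f (w (s + \<delta>)))"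
    unfolding eventually_at_top_linorder by auto
  define S where "S = max 0 S0"
  have S: "0 \<le> S" "S0 \<le> S"
    by (auto simp: S_def)
  have decay: "c * (1 - cmod (w (s + \<delta>))) \<le> 1 - cmod (w s)" if "S \<le> s" for s
    using S0[of s] f_w[of s] S that by simp
  \<comment> \<open>The sum of the geometric series \<open>2 (1 + 1/c + 1/c\<^sup>2 + \<dots>)\<close>; the fixed point equation
    \<open>2 + K / c = K\<close> makes the estimate below telescope.\<close>
  define K where "K = 2 * c / (c - 1)"
  have K: "1 \<le> K" "2 + K / c = K"
    using c(1) by (simp_all add: K_def field_simps)
  have step: "cmod (w s - w (s + \<delta>)) + K * (1 - cmod (w (s + \<delta>))) \<le> K * (1 - cmod (w s))"
    if s: "S \<le> s" for s
  proof -
    have s0: "0 \<le> s" "0 \<le> s + \<delta>"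
      using s S \<delta> by auto
    have "cmod (w s - w (s + \<delta>)) \<le> 2 * (1 - cmod (w s))"
      using steps[of s \<delta>] s0 \<delta>
      by (intro norm_diff_le_of_pseudo_dist_half w_disk) (auto simp: pseudo_dist_commute)
    moreover have "K * (1 - cmod (w (s + \<delta>))) \<le> K * ((1 - cmod (w s)) / c)"
      using decay[OF s] c(1) K(1) by (intro mult_left_mono) (auto simp: field_simps)
    ultimately have "cmod (w s - w (s + \<delta>)) + K * (1 - cmod (w (s + \<delta>)))
        \<le> (2 + K / c) * (1 - cmod (w s))"
      by (simp add: distrib_right)
    then show ?thesis
      unfolding K(2) .
  qed
  have sum: "cmod (w s - w (s + real n * \<delta>)) + K * (1 - cmod (w (s + real n * \<delta>))) \<le> K * (1 - cmod (w s))"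
    if s: "S \<le> s" for s n
  proof (induction n)
    case 0
    then show ?case by simp
  next
    case (Suc n)
    have "0 \<le> real n * \<delta>"
      using \<delta> by simp
    then have "S \<le> s + real n * \<delta>"
      using s by linarith
    note st = step[OF this]
    have eq: "s + real (Suc n) * \<delta> = s + real n * \<delta> + \<delta>"
      by (simp add: algebra_simps)
    have "cmod (w s - w (s + real n * \<delta> + \<delta>))
        \<le> cmod (w s - w (s + real n * \<delta>)) + cmod (w (s + real n * \<delta>) - w (s + real n * \<delta> + \<delta>))"
      using norm_triangle_ineq[of "w s - w (s + real n * \<delta>)" "w (s + real n * \<delta>) - w (s + real n * \<delta> + \<delta>)"]
      by simp
    then show ?case
      unfolding eq using st Suc.IH by linarith
  qed
  have "cmod (w s - \<sigma>) \<le> K * (1 - cmod (w s))" if s: "S \<le> s" for s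
  proof (rule tendsto_upperbound)
    have "filterlim (\<lambda>n. s + real n * \<delta>) at_top sequentially"
      using \<delta> by real_asymp
    then have "((\<lambda>n. w (s + real n * \<delta>)) \<longlongrightarrow> \<sigma>) sequentially"
      by (rule filterlim_compose[OF w_lim])
    then show "((\<lambda>n. cmod (w s - w (s + real n * \<delta>))) \<longlongrightarrow> cmod (w s - \<sigma>)) sequentially"
      by (intro tendsto_intros)
    show "eventually (\<lambda>n. cmod (w s - w (s + real n * \<delta>)) \<le> K * (1 - cmod (w s))) sequentially"
    proof (rule always_eventually, rule allI)
      fix n
      have "0 \<le> real n * \<delta>"
        using \<delta> by simp
      then have "0 \<le> K * (1 - cmod (w (s + real n * \<delta>)))"
        using w_disk[of "s + real n * \<delta>"] S s K(1) by (intro mult_nonneg_nonneg) auto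
      then show "cmod (w s - w (s + real n * \<delta>)) \<le> K * (1 - cmod (w s))"
        using sum[OF s, of n] by linarith
    qed
  qed simp
  then show thesis
    using that K(1) S(1) by blast
qed

lemma eventually_in_stolz_region: "\<exists>M>1. eventually (\<lambda>s. w s \<in> stolz_region \<sigma> M) at_top"
proof -
  obtain K S where K: "1 \<le> K" "0 \<le> S" "\<And>s. S \<le> s \<Longrightarrow> cmod (w s - \<sigma>) \<le> K * (1 - cmod (w s))"
    using nontangential by metis
  have "eventually (\<lambda>s. w s \<in> stolz_region \<sigma> (K + 1)) at_top"
    using eventually_ge_at_top[of S]
  proof eventually_elim
    case (elim s)
    have "cmod (w s) < 1"
      using w_disk elim K(2) by simp
    moreover have "cmod (\<sigma> - w s) < (K + 1) * (1 - cmod (w s))"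
      using K(3)[OF elim] \<open>cmod (w s) < 1\<close> by (simp add: norm_minus_commute distrib_right)
    ultimately show ?case
      by (simp add: stolz_region_def)
  qed
  then show ?thesis
    using K(1) by (intro exI[of _ "K + 1"]) auto
qed

text \<open>Because the approach to \<open>\<sigma>\<close> is nontangential, the angular derivative is the limit of the
  difference quotients of \<open>f\<close> along the orbit, and \<open>f\<close> moves the orbit one step back.\<close>
lemma boundary_distance_increments:
  "((\<lambda>s. - ln (cmod (w (s + \<delta>) - \<sigma>)) - - ln (cmod (w s - \<sigma>))) \<longlongrightarrow> \<alpha> * \<delta>) at_top"
proof -
  obtain M where M: "1 < M" "eventually (\<lambda>s. w s \<in> stolz_region \<sigma> M) at_top"
    using eventually_in_stolz_region by blast
  have ne: "w s \<noteq> \<sigma>" if "0 \<le> s" for s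
    using w_disk[OF that] \<sigma> by auto
  have "filterlim (\<lambda>s::real. s + \<delta>) at_top at_top"
    by real_asymp
  then have "eventually (\<lambda>s. w (s + \<delta>) \<in> stolz_region \<sigma> M) at_top"
    using M(2) eventually_compose_filterlim by blast
  then have "eventually (\<lambda>s. w (s + \<delta>) \<in> stolz_region \<sigma> M \<and> w (s + \<delta>) \<noteq> \<sigma>) at_top"
    using eventually_ge_at_top[of 0] by eventually_elim (use ne \<delta> in auto)
  then have "filterlim (\<lambda>s. w (s + \<delta>)) (at \<sigma> within stolz_region \<sigma> M) at_top"
    unfolding filterlim_at using w_shift_lim by simp
  moreover have "((\<lambda>z. (f z - \<sigma>) / (z - \<sigma>)) \<longlongrightarrow> of_real (exp (\<alpha> * \<delta>))) (at \<sigma> within stolz_region \<sigma> M)"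
    using deriv M(1) unfolding has_angular_derivative_at_fixed_def has_angular_limit_def by simp
  ultimately have "((\<lambda>s. (f (w (s + \<delta>)) - \<sigma>) / (w (s + \<delta>) - \<sigma>)) \<longlongrightarrow> of_real (exp (\<alpha> * \<delta>))) at_top"
    by (rule filterlim_compose[rotated])
  then have "((\<lambda>s. ln (cmod ((f (w (s + \<delta>)) - \<sigma>) / (w (s + \<delta>) - \<sigma>)))) \<longlongrightarrow> ln (cmod (of_real (exp (\<alpha> * \<delta>))))) at_top"
    by (intro tendsto_ln tendsto_norm) auto
  moreover have "eventually (\<lambda>s. ln (cmod ((f (w (s + \<delta>)) - \<sigma>) / (w (s + \<delta>) - \<sigma>)))
      = - ln (cmod (w (s + \<delta>) - \<sigma>)) - - ln (cmod (w s - \<sigma>))) at_top"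
    using eventually_ge_at_top[of 0]
  proof eventually_elim
    case (elim s)
    have "w s \<noteq> \<sigma>" "w (s + \<delta>) \<noteq> \<sigma>"
      using ne elim \<delta> by auto
    then show ?case
      using f_w[OF elim] by (simp add: norm_divide ln_div)
  qed
  ultimately show ?thesis
    using Lim_transform_eventually by fastforce
qed

lemma hyp_dist_rate:
  assumes z: "cmod z < 1"
  shows "((\<lambda>s. hyp_dist z (w s) / s) \<longlongrightarrow> \<alpha> / 2) at_top"
proof -
  obtain K S where K: "1 \<le> K" "0 \<le> S" "\<And>s. S \<le> s \<Longrightarrow> cmod (w s - \<sigma>) \<le> K * (1 - cmod (w s))"
    using nontangential by metis
  define q where "q = (\<lambda>s. - ln (cmod (w s - \<sigma>)))"
  define D where "D = (\<lambda>s. hyp_dist 0 (w s))"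
  have compare: "\<bar>2 * D s - q s\<bar> \<le> ln 2 + ln K" if s: "S \<le> s" for s
  proof -
    have w1: "cmod (w s) < 1"
      using w_disk s K(2) by simp
    have "D s = artanh (cmod (w s))"
      by (simp add: D_def hyp_dist_eq_artanh pseudo_dist_zero_left)
    then have "- ln (1 - cmod (w s)) \<le> 2 * D s" "2 * D s \<le> ln 2 - ln (1 - cmod (w s))"
      using artanh_real_ge_ln[of "cmod (w s)"] artanh_real_le_ln[of "cmod (w s)"] w1 by auto
    moreover have low: "1 - cmod (w s) \<le> cmod (w s - \<sigma>)"
      using norm_triangle_ineq3[of \<sigma> "w s"] \<sigma> by (simp add: norm_minus_commute)
    have "ln (1 - cmod (w s)) \<le> ln (cmod (w s - \<sigma>))"
      using low w1 by (intro ln_mono) auto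
    moreover have "ln (cmod (w s - \<sigma>)) \<le> ln (K * (1 - cmod (w s)))"
      using K(3)[OF s] low w1 by (intro ln_mono) auto
    moreover have "ln (K * (1 - cmod (w s))) = ln K + ln (1 - cmod (w s))"
      using K(1) w1 by (intro ln_mult_pos) auto
    moreover have "0 \<le> ln K" "0 \<le> ln (2::real)"
      using K(1) by auto
    ultimately show ?thesis
      unfolding q_def by linarith
  qed
  have D_steps: "\<bar>D (s + u) - D s\<bar> \<le> artanh (1/2)" if "0 \<le> s" "0 \<le> u" "u \<le> \<delta>" for s u
  proof -
    have 1: "cmod (w s) < 1" "cmod (w (s + u)) < 1"
      using w_disk that by auto
    have "hyp_dist (w (s + u)) (w s) \<le> artanh (1/2)"
      unfolding hyp_dist_eq_artanh using steps[OF that] pseudo_dist_nonneg[of "w (s + u)" "w s"]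
      by (intro artanh_real_mono) auto
    then show ?thesis
      using hyp_dist_triangle[of 0 "w s" "w (s + u)"] hyp_dist_triangle[of 0 "w (s + u)" "w s"] 1
        hyp_dist_commute[of "w s" "w (s + u)"]
      by (simp add: D_def abs_le_iff)
  qed
  have "((\<lambda>s. q s / s) \<longlongrightarrow> \<alpha> * \<delta> / \<delta>) at_top"
  proof (rule linear_growth_of_convergent_increments[OF \<delta>])
    show "((\<lambda>s. q (s + \<delta>) - q s) \<longlongrightarrow> \<alpha> * \<delta>) at_top"
      unfolding q_def by (rule boundary_distance_increments)
    fix s u assume "S \<le> s" "0 \<le> u" "u \<le> \<delta>"
    then show "\<bar>q (s + u) - q s\<bar> \<le> 2 * (ln 2 + ln K) + 2 * artanh (1/2)"
      using compare[of s] compare[of "s + u"] D_steps[of s u] K(2) by (simp add: abs_le_iff)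
  qed
  then have q: "((\<lambda>s. q s / s) \<longlongrightarrow> \<alpha>) at_top"
    using \<delta> by simp
  have "((\<lambda>s. (2 * hyp_dist z (w s)) / s) \<longlongrightarrow> \<alpha>) at_top"
  proof (rule tendsto_ratio_of_bounded_diff[OF q])
    show "eventually (\<lambda>s. \<bar>2 * hyp_dist z (w s) - q s\<bar> \<le> 2 * hyp_dist z 0 + (ln 2 + ln K)) at_top"
      using eventually_ge_at_top[of S]
    proof eventually_elim
      case (elim s)
      have "cmod (w s) < 1"
        using w_disk elim K(2) by simp
      then have "hyp_dist z (w s) \<le> hyp_dist z 0 + D s" "D s \<le> hyp_dist z 0 + hyp_dist z (w s)"
        using hyp_dist_triangle[of z 0 "w s"] hyp_dist_triangle[of 0 z "w s"] z
        by (auto simp: D_def hyp_dist_commute[of 0 z])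
      then show ?case
        using compare[OF elim] by (simp add: abs_le_iff)
    qed
  qed
  then have "((\<lambda>s. (2 * hyp_dist z (w s)) / s / 2) \<longlongrightarrow> \<alpha> / 2) at_top"
    by (intro tendsto_intros) auto
  then show ?thesis
    by simp
qed

end

section \<open>Translations of a half-plane\<close>

text \<open>Both points are joined through the centre \<open>c\<close>.\<close>
lemma hyp_dist_le_of_ball:
  assumes f: "f holomorphic_on ball c r" "f ` ball c r \<subseteq> unit_disk"
    and r: "0 < r" and t: "0 \<le> t" "t < 1" and ab: "cmod (a - c) \<le> t * r" "cmod (b - c) \<le> t * r"
  shows "hyp_dist (f a) (f b) \<le> ln 2 - ln (1 - t)"
proof -
  have tr: "t * r < r"
    using r t by simp
  have in_ball: "a \<in> ball c r" "b \<in> ball c r"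
    using ab tr by (auto simp: dist_norm norm_minus_commute)
  have f1: "cmod (f x) < 1" if "x \<in> ball c r" for x
    using f(2) that by (auto simp: image_subset_iff)
  have le: "hyp_dist (f c) (f x) \<le> artanh t" if "x \<in> ball c r" "cmod (x - c) \<le> t * r" for x
  proof -
    have "pseudo_dist (f c) (f x) \<le> cmod (x - c) / r"
      using Schwarz_Pick_ball[OF f that(1)] .
    also have "\<dots> \<le> t"
      using that(2) r by (simp add: field_simps)
    finally show ?thesis
      unfolding hyp_dist_eq_artanh using pseudo_dist_nonneg[of "f c" "f x"] t
      by (intro artanh_real_mono) auto
  qed
  have "hyp_dist (f a) (f b) \<le> hyp_dist (f a) (f c) + hyp_dist (f c) (f b)"
    using f1 in_ball r by (intro hyp_dist_triangle) auto
  also have "\<dots> \<le> 2 * artanh t"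
    using le[OF in_ball(1) ab(1)] le[OF in_ball(2) ab(2)] hyp_dist_commute[of "f a" "f c"] by simp
  also have "\<dots> \<le> ln 2 - ln (1 - t)"
    using t by (rule artanh_real_le_ln)
  finally show ?thesis .
qed

text \<open>The sign \<open>\<epsilon>\<close> selects the upper or the lower half-plane bounded by the line \<open>Im \<zeta> = a\<close>, and
  \<open>\<kappa>\<close> is the distance of \<open>p\<close> to that line. Both \<open>p\<close> and \<open>p - s\<close> lie in a
  large disk inside the half-plane, tangent to its boundary, with centre above or below the midpoint of
  the two points. For the radius \<open>R + \<kappa>\<close> with \<open>R = s\<^sup>2 / \<kappa>\<close> the two points keep at least the
  distance \<open>7 \<kappa> / 8\<close> from the circle, so that their hyperbolic distance is at most the logarithm of a quadratic
  polynomial in \<open>s\<close>.\<close>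
lemma hyp_dist_translation_half_plane:
  fixes a \<epsilon> :: real
  defines "H \<equiv> {\<zeta>. 0 < \<epsilon> * (Im \<zeta> - a)}"
  assumes \<epsilon>: "\<bar>\<epsilon>\<bar> = 1" and f: "f holomorphic_on H" "f ` H \<subseteq> unit_disk" and p: "p \<in> H"
  shows "((\<lambda>s. hyp_dist (f p) (f (p - of_real s)) / s) \<longlongrightarrow> 0) at_top"
proof -
  define \<kappa> where "\<kappa> = \<epsilon> * (Im p - a)"
  have \<kappa>: "0 < \<kappa>"
    using p by (simp add: \<kappa>_def H_def)
  have \<epsilon>2: "\<epsilon> * \<epsilon> = 1"
    using \<epsilon> by (metis abs_mult_self_eq mult_1)
  have in_H: "p - of_real s \<in> H" for s
    using p by (simp add: H_def)
  have bound: "hyp_dist (f p) (f (p - of_real s)) \<le> ln 2 + ln (8 / 7 * (1 + s\<^sup>2 / \<kappa>\<^sup>2))" for s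
  proof -
    define R where "R = s\<^sup>2 / \<kappa>"
    have R: "0 \<le> R" "R * \<kappa> = s\<^sup>2"
      using \<kappa> by (simp_all add: R_def)
    define c where "c = p - of_real (s / 2) + \<i> * of_real (\<epsilon> * R)"
    define t where "t = (R + \<kappa> / 8) / (R + \<kappa>)"
    have t: "0 \<le> t" "t < 1" "1 - t = 7 / 8 * \<kappa> / (R + \<kappa>)" "t * (R + \<kappa>) = R + \<kappa> / 8"
      using R(1) \<kappa> by (simp_all add: t_def field_simps)
    have sub: "ball c (R + \<kappa>) \<subseteq> H"
    proof
      fix x assume "x \<in> ball c (R + \<kappa>)"
      then have "\<bar>Im (x - c)\<bar> < R + \<kappa>"
        using abs_Im_le_cmod[of "x - c"] by (simp add: dist_norm norm_minus_commute)
      then have "\<bar>\<epsilon> * Im (x - c)\<bar> < R + \<kappa>"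
        using \<epsilon> by (simp add: abs_mult)
      moreover have "\<epsilon> * (Im x - a) = \<kappa> + \<epsilon> * \<epsilon> * R + \<epsilon> * Im (x - c)"
        by (simp add: \<kappa>_def c_def algebra_simps)
      ultimately show "x \<in> H"
        unfolding H_def \<epsilon>2 by (simp add: abs_less_iff)
    qed
    have near: "cmod \<zeta> \<le> t * (R + \<kappa>)" if "\<bar>Re \<zeta>\<bar> = \<bar>s\<bar> / 2" "\<bar>Im \<zeta>\<bar> = R" for \<zeta>
    proof -
      have "(cmod \<zeta>)\<^sup>2 = \<bar>Re \<zeta>\<bar>\<^sup>2 + \<bar>Im \<zeta>\<bar>\<^sup>2"
        by (simp add: cmod_power2)
      also have "\<dots> = s\<^sup>2 / 4 + R\<^sup>2"
        unfolding that by (simp add: power_divide)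
      also have "\<dots> \<le> (R + \<kappa> / 8)\<^sup>2"
        using R(2) by (simp add: power2_eq_square algebra_simps)
      finally have "cmod \<zeta> \<le> R + \<kappa> / 8"
        by (rule power2_le_imp_le) (use R(1) \<kappa> in auto)
      then show ?thesis
        by (simp add: t(4))
    qed
    have "hyp_dist (f p) (f (p - of_real s)) \<le> ln 2 - ln (1 - t)"
    proof (rule hyp_dist_le_of_ball[where f = f and c = c and r = "R + \<kappa>" and t = t])
      show "f holomorphic_on ball c (R + \<kappa>)"
        using f(1) sub by (rule holomorphic_on_subset)
      show "f ` ball c (R + \<kappa>) \<subseteq> unit_disk"
        using f(2) sub by blast
      show "cmod (p - c) \<le> t * (R + \<kappa>)" "cmod (p - of_real s - c) \<le> t * (R + \<kappa>)"
        using R(1) \<epsilon> by (auto intro!: near simp: c_def abs_mult)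
    qed (use R(1) \<kappa> t in auto)
    also have "\<dots> = ln 2 + ln (1 / (1 - t))"
      using t by (simp add: ln_div)
    also have "1 / (1 - t) = 8 / 7 * (1 + s\<^sup>2 / \<kappa>\<^sup>2)"
      using \<kappa> R(1) unfolding t(3) by (simp add: R_def field_simps power2_eq_square)
    finally show ?thesis
      by simp
  qed
  show ?thesis
  proof (rule tendsto_sandwich)
    show "eventually (\<lambda>s. 0 \<le> hyp_dist (f p) (f (p - of_real s)) / s) at_top"
      using eventually_gt_at_top[of 0]
    proof eventually_elim
      case (elim s)
      have "0 \<le> hyp_dist (f p) (f (p - of_real s))"
        using f(2) p in_H[of s] by (intro hyp_dist_nonneg) (auto simp: image_subset_iff)
      then show ?case
        using elim by simp
    qed
    show "eventually (\<lambda>s. hyp_dist (f p) (f (p - of_real s)) / s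
        \<le> (ln 2 + ln (8 / 7 * (1 + s\<^sup>2 / \<kappa>\<^sup>2))) / s) at_top"
      using eventually_gt_at_top[of 0] by eventually_elim (use bound in \<open>simp add: divide_right_mono\<close>)
    show "((\<lambda>s. (ln 2 + ln (8 / 7 * (1 + s\<^sup>2 / \<kappa>\<^sup>2))) / s) \<longlongrightarrow> 0) at_top"
      using \<kappa> by real_asymp
  qed simp
qed


section \<open>The speeds of a petal\<close>

text \<open>The backward orbits of a petal satisfy the hypotheses of the preceding analysis with
  \<open>f = \<phi>\<^sub>\<delta>\<close>, where \<open>\<delta>\<close> is the duration for which the steps are bounded.\<close>
lemma hyperbolic_petal_orbit:
  assumes \<phi>: "disk_semigroup \<phi>" and \<Delta>: "petal \<phi> \<Delta>" and z: "z \<in> \<Delta>"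
    and \<sigma>: "petal_repelling_point \<phi> \<Delta> \<sigma>" and lam: "repelling_spectral_value \<phi> \<sigma> lam"
  shows "((\<lambda>s. hyp_dist z (backward_orbit \<phi> \<Delta> z (-s)) / s) \<longlongrightarrow> - lam / 2) at_top"
    and "\<exists>M. eventually (\<lambda>s. backward_orbit \<phi> \<Delta> z (-s) \<in> stolz_region \<sigma> M) at_top"
proof -
  have z1: "cmod z < 1"
    using z petal_subset_disk[OF \<phi> \<Delta>] by auto
  obtain \<delta> where \<delta>: "0 < \<delta>"
    and steps: "\<And>s u. 0 \<le> s \<Longrightarrow> 0 \<le> u \<Longrightarrow> u \<le> \<delta>
      \<Longrightarrow> pseudo_dist (backward_orbit \<phi> \<Delta> z (-(s + u))) (backward_orbit \<phi> \<Delta> z (-s)) \<le> 1/2"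
    using backward_orbit_bounded_steps[OF \<phi> \<Delta> z] by blast
  interpret repelling_backward_orbit "\<phi> \<delta>" "\<lambda>s. backward_orbit \<phi> \<Delta> z (-s)" \<sigma> \<delta> "- lam"
  proof
    show "\<phi> \<delta> holomorphic_on unit_disk" "\<phi> \<delta> ` unit_disk \<subseteq> unit_disk"
      using \<phi> \<delta> by (simp_all add: disk_semigroup_def)
    show "cmod \<sigma> = 1"
      using lam
      by (simp add: repelling_spectral_value_def repelling_fixed_point_def regular_fixed_point_def
          boundary_fixed_point_def)
    show "0 < - lam" "has_angular_derivative_at_fixed (\<phi> \<delta>) \<sigma> (of_real (exp (- lam * \<delta>)))"
      using lam \<delta> by (simp_all add: repelling_spectral_value_def)
    show "((\<lambda>s. backward_orbit \<phi> \<Delta> z (- s)) \<longlongrightarrow> \<sigma>) at_top"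
      using \<sigma> z unfolding petal_repelling_point_def filterlim_at_bot_mirror by blast
    show "cmod (backward_orbit \<phi> \<Delta> z (- s)) < 1" if "0 \<le> s" for s
      using backward_orbit_in_disk[OF \<phi> \<Delta> z that] .
    show "\<phi> \<delta> (backward_orbit \<phi> \<Delta> z (- (s + \<delta>))) = backward_orbit \<phi> \<Delta> z (- s)" if "0 \<le> s" for s
      using backward_orbit_step[OF \<phi> \<Delta> z that] \<delta> by simp
    show "pseudo_dist (backward_orbit \<phi> \<Delta> z (- (s + u))) (backward_orbit \<phi> \<Delta> z (- s)) \<le> 1 / 2"
      if "0 \<le> s" "0 \<le> u" "u \<le> \<delta>" for s u
      using steps that .
  qed (fact \<delta>)
  show "((\<lambda>s. hyp_dist z (backward_orbit \<phi> \<Delta> z (-s)) / s) \<longlongrightarrow> - lam / 2) at_top"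
    using hyp_dist_rate[OF z1] .
  show "\<exists>M. eventually (\<lambda>s. backward_orbit \<phi> \<Delta> z (-s) \<in> stolz_region \<sigma> M) at_top"
    using eventually_in_stolz_region by blast
qed

lemma parabolic_petal_orbit:
  assumes \<phi>: "disk_semigroup \<phi>" and \<Delta>: "parabolic_petal \<phi> \<Delta>" and z: "z \<in> \<Delta>"
  shows "((\<lambda>s. hyp_dist z (backward_orbit \<phi> \<Delta> z (-s)) / s) \<longlongrightarrow> 0) at_top"
proof -
  have petal: "petal \<phi> \<Delta>"
    using \<Delta> by (simp add: parabolic_petal_def)
  obtain h where h: "koenigs_function \<phi> h" and "horizontal_half_plane (h ` \<Delta>)"
    using \<Delta> unfolding parabolic_petal_def maximal_in_def by blast
  then obtain a where a: "h ` \<Delta> = {w. a < Im w} \<or> h ` \<Delta> = {w. Im w < a}"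
    unfolding horizontal_half_plane_def by blast
  obtain \<epsilon> :: real where \<epsilon>: "\<bar>\<epsilon>\<bar> = 1" and H: "h ` \<Delta> = {\<zeta>. 0 < \<epsilon> * (Im \<zeta> - a)}"
  proof (cases "h ` \<Delta> = {w. a < Im w}")
    case True
    then show thesis
      by (intro that[of 1]) auto
  next
    case False
    then show thesis
      using a by (intro that[of "-1"]) auto
  qed
  have sub: "\<Delta> \<subseteq> unit_disk"
    using \<phi> petal by (rule petal_subset_disk)
  have "open \<Delta>"
    using petal open_components open_interior unfolding petal_def by blast
  moreover have "h holomorphic_on \<Delta>" "inj_on h \<Delta>"
    using h sub unfolding koenigs_function_def by (auto intro: holomorphic_on_subset inj_on_subset)
  ultimately obtain g where g: "g holomorphic_on h ` \<Delta>" "\<And>x. x \<in> \<Delta> \<Longrightarrow> g (h x) = x"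
    using holomorphic_has_inverse by metis
  have g_maps: "g ` h ` \<Delta> \<subseteq> unit_disk"
    using g(2) sub by auto
  have "((\<lambda>s. hyp_dist (g (h z)) (g (h z - of_real s)) / s) \<longlongrightarrow> 0) at_top"
  proof (rule hyp_dist_translation_half_plane[OF \<epsilon>])
    show "g holomorphic_on {\<zeta>. 0 < \<epsilon> * (Im \<zeta> - a)}" "g ` {\<zeta>. 0 < \<epsilon> * (Im \<zeta> - a)} \<subseteq> unit_disk"
      using g(1) g_maps unfolding H by auto
    show "h z \<in> {\<zeta>. 0 < \<epsilon> * (Im \<zeta> - a)}"
      unfolding H[symmetric] using z by (rule imageI)
  qed
  moreover have "eventually (\<lambda>s. hyp_dist (g (h z)) (g (h z - of_real s)) / s
      = hyp_dist z (backward_orbit \<phi> \<Delta> z (-s)) / s) at_top"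
    using eventually_ge_at_top[of 0]
  proof eventually_elim
    case (elim s)
    let ?w = "backward_orbit \<phi> \<Delta> z (-s)"
    have w: "?w \<in> \<Delta>" "\<phi> s ?w = z"
      using backward_orbit_in_petal[OF \<phi> petal z elim] by auto
    have "h (\<phi> s ?w) = h ?w + of_real s"
      using h elim w(1) sub unfolding koenigs_function_def by blast
    then have "g (h z - of_real s) = ?w"
      using w g(2) by simp
    then show ?case
      using g(2) z by simp
  qed
  ultimately show ?thesis
    by (rule Lim_transform_eventually)
qed

text \<open>Only the triangle inequality relates the two speeds to the distance from the starting point;
  the error it leaves is at most the tangential speed, which is negligible in both cases.\<close>
lemma speeds_triangle:
  assumes \<phi>: "disk_semigroup \<phi>" and \<Delta>: "petal \<phi> \<Delta>" and z: "z \<in> \<Delta>"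
    and \<eta>: "full_geodesic \<eta>" "\<eta> 0 = z" and s: "0 \<le> s"
  shows "0 \<le> tangential_speed \<phi> \<Delta> z \<eta> (-s)"
    and "tangential_speed \<phi> \<Delta> z \<eta> (-s) \<le> hyp_dist z (backward_orbit \<phi> \<Delta> z (-s))"
    and "\<bar>orthogonal_speed \<phi> \<Delta> z \<eta> (-s) - hyp_dist z (backward_orbit \<phi> \<Delta> z (-s))\<bar>
      \<le> tangential_speed \<phi> \<Delta> z \<eta> (-s)"
proof -
  define w where "w = backward_orbit \<phi> \<Delta> z (-s)"
  define p where "p = geodesic_projection \<eta> w"
  have z1: "cmod z < 1"
    using z petal_subset_disk[OF \<phi> \<Delta>] by auto
  have w1: "cmod w < 1"
    unfolding w_def using backward_orbit_in_disk[OF \<phi> \<Delta> z s] .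
  have p: "p \<in> \<eta> ` {-1<..<1}" "hyp_dist w p = tangential_speed \<phi> \<Delta> z \<eta> (-s)"
    using geodesic_projection[OF \<eta>(1) w1] by (simp_all add: p_def w_def tangential_speed_def)
  then have p1: "cmod p < 1"
    using \<eta>(1) unfolding full_geodesic_def by auto
  show "0 \<le> tangential_speed \<phi> \<Delta> z \<eta> (-s)"
    using hyp_dist_nonneg[OF w1 p1] p(2) by simp
  show "tangential_speed \<phi> \<Delta> z \<eta> (-s) \<le> hyp_dist z (backward_orbit \<phi> \<Delta> z (-s))"
    using dist_to_geodesic_le[OF \<eta>(1) w1, of 0] \<eta>(2)
    by (simp add: tangential_speed_def w_def hyp_dist_commute[of z])
  have o: "orthogonal_speed \<phi> \<Delta> z \<eta> (-s) = hyp_dist z p"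
    by (simp add: orthogonal_speed_def p_def w_def)
  show "\<bar>orthogonal_speed \<phi> \<Delta> z \<eta> (-s) - hyp_dist z (backward_orbit \<phi> \<Delta> z (-s))\<bar>
      \<le> tangential_speed \<phi> \<Delta> z \<eta> (-s)"
    unfolding o w_def[symmetric] p(2)[symmetric]
    using hyp_dist_triangle[OF z1 w1 p1] hyp_dist_triangle[OF z1 p1 w1] hyp_dist_commute[of w p]
    by (simp add: abs_le_iff)
qed

lemma tendsto_at_bot_of_reflected_ratio:
  fixes f :: "real \<Rightarrow> real"
  assumes "((\<lambda>s. f (-s) / s) \<longlongrightarrow> l) at_top"
  shows "((\<lambda>t. f t / t) \<longlongrightarrow> - l) at_bot"
  unfolding filterlim_at_bot_mirror using tendsto_minus[OF assms] by simp

theorem corollary5p1: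
  fixes \<phi> :: "real \<Rightarrow> complex \<Rightarrow> complex" and \<Delta> :: "complex set"
    and z :: complex and \<eta> :: "real \<Rightarrow> complex"
  assumes "disk_semigroup \<phi>" and "\<not> disk_group \<phi>"
    and "petal \<phi> \<Delta>" and "z \<in> \<Delta>" and "petal_geodesic \<phi> \<Delta> z \<eta>"
  shows "(\<forall>lam::real. hyperbolic_petal \<phi> \<Delta> \<and> petal_spectral_value \<phi> \<Delta> lam \<longrightarrow>
            ((\<lambda>t. orthogonal_speed \<phi> \<Delta> z \<eta> t / t) \<longlongrightarrow> lam / 2) at_bot \<and>
            ((\<lambda>t. tangential_speed \<phi> \<Delta> z \<eta> t / t) \<longlongrightarrow> 0) at_bot) \<and>
         (parabolic_petal \<phi> \<Delta> \<longrightarrow>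
            ((\<lambda>t. orthogonal_speed \<phi> \<Delta> z \<eta> t / t) \<longlongrightarrow> 0) at_bot \<and>
            ((\<lambda>t. tangential_speed \<phi> \<Delta> z \<eta> t / t) \<longlongrightarrow> 0) at_bot)"
proof (intro conjI allI impI)
  note \<phi> = assms(1) and \<Delta> = assms(3) and z = assms(4)
  let ?D = "\<lambda>s. hyp_dist z (backward_orbit \<phi> \<Delta> z (-s))"
  let ?T = "tangential_speed \<phi> \<Delta> z \<eta>" and ?O = "orthogonal_speed \<phi> \<Delta> z \<eta>"
  have \<eta>: "full_geodesic \<eta>" "\<eta> 0 = z"
    using assms(5) by (simp_all add: petal_geodesic_def)
  note speeds = speeds_triangle[OF \<phi> \<Delta> z \<eta>]

  have "((\<lambda>t. ?O t / t) \<longlongrightarrow> lam / 2) at_bot \<and> ((\<lambda>t. ?T t / t) \<longlongrightarrow> 0) at_bot"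
    if lam: "petal_spectral_value \<phi> \<Delta> lam" for lam
  proof -
    obtain \<sigma> where \<sigma>: "petal_repelling_point \<phi> \<Delta> \<sigma>" "repelling_spectral_value \<phi> \<sigma> lam"
      using lam by (auto simp: petal_spectral_value_def)
    have rate: "((\<lambda>s. ?D s / s) \<longlongrightarrow> - lam / 2) at_top"
      using hyperbolic_petal_orbit(1)[OF \<phi> \<Delta> z \<sigma>] .
    have lam0: "lam < 0"
      using \<sigma>(2) by (simp add: repelling_spectral_value_def)
    \<comment> \<open>The definition of the geodesic offers the Denjoy--Wolff point as its endpoint if the petal is
      parabolic; the positive rate excludes this.\<close>
    have "\<not> parabolic_petal \<phi> \<Delta>"
    proof
      assume "parabolic_petal \<phi> \<Delta>"
      then have "((\<lambda>s. ?D s / s) \<longlongrightarrow> 0) at_top"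
        using parabolic_petal_orbit \<phi> z by blast
      then have "- lam / 2 = 0"
        using rate tendsto_unique trivial_limit_at_top_linorder by blast
      then show False
        using lam0 by simp
    qed
    then obtain p where p: "petal_repelling_point \<phi> \<Delta> p" "(\<eta> \<longlongrightarrow> p) (at_left 1)"
      using assms(5) unfolding petal_geodesic_def by blast
    have "p = \<sigma>"
      using \<sigma>(1) p(1) z tendsto_unique trivial_limit_at_bot_linorder
      unfolding petal_repelling_point_def by blast
    then have \<eta>_lim: "(\<eta> \<longlongrightarrow> \<sigma>) (at_left 1)"
      using p(2) by simp
    have "cmod \<sigma> = 1"
      using \<sigma>(2)
      by (simp add: repelling_spectral_value_def repelling_fixed_point_def regular_fixed_point_def
          boundary_fixed_point_def)
    obtain M where M: "eventually (\<lambda>s. backward_orbit \<phi> \<Delta> z (-s) \<in> stolz_region \<sigma> M) at_top"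
      using hyperbolic_petal_orbit(2)[OF \<phi> \<Delta> z \<sigma>] by blast
    obtain C where "\<And>w. w \<in> stolz_region \<sigma> M \<Longrightarrow> dist_to_geodesic w \<eta> \<le> C"
      using dist_to_geodesic_bounded_in_stolz_region[OF \<eta>(1) \<eta>_lim \<open>cmod \<sigma> = 1\<close>] by metis
    then have T: "eventually (\<lambda>s. ?T (-s) \<le> C) at_top"
      using M by (auto simp: tangential_speed_def elim: eventually_mono)
    have "((\<lambda>s. ?T (-s) / s) \<longlongrightarrow> 0) at_top"
    proof (rule tendsto_ratio_of_bounded_diff)
      show "((\<lambda>s::real. 0 / s) \<longlongrightarrow> 0) at_top"
        by simp
      show "eventually (\<lambda>s. \<bar>?T (-s) - 0\<bar> \<le> C) at_top"
        using T eventually_ge_at_top[of 0] by eventually_elim (use speeds(1) in auto)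
    qed
    moreover have "((\<lambda>s. ?O (-s) / s) \<longlongrightarrow> - lam / 2) at_top"
    proof (rule tendsto_ratio_of_bounded_diff[OF rate])
      show "eventually (\<lambda>s. \<bar>?O (-s) - ?D s\<bar> \<le> C) at_top"
        using T eventually_ge_at_top[of 0] by eventually_elim (use speeds(3) order_trans in blast)
    qed
    ultimately show ?thesis
      using tendsto_at_bot_of_reflected_ratio[of ?T 0] tendsto_at_bot_of_reflected_ratio[of ?O "- lam / 2"]
      by simp
  qed
  then show "((\<lambda>t. ?O t / t) \<longlongrightarrow> lam / 2) at_bot" "((\<lambda>t. ?T t / t) \<longlongrightarrow> 0) at_bot"
    if "hyperbolic_petal \<phi> \<Delta> \<and> petal_spectral_value \<phi> \<Delta> lam" for lam
    using that by blast+

  have "((\<lambda>t. ?O t / t) \<longlongrightarrow> 0) at_bot \<and> ((\<lambda>t. ?T t / t) \<longlongrightarrow> 0) at_bot" if "parabolic_petal \<phi> \<Delta>"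
  proof -
    have rate: "((\<lambda>s. ?D s / s) \<longlongrightarrow> 0) at_top"
      using parabolic_petal_orbit \<phi> that z by blast
    have "((\<lambda>s. ?T (-s) / s) \<longlongrightarrow> 0) at_top"
    proof (rule Lim_null_comparison[OF _ rate])
      show "eventually (\<lambda>s. norm (?T (-s) / s) \<le> ?D s / s) at_top"
        using eventually_gt_at_top[of 0]
        by eventually_elim (use speeds(1,2) in \<open>simp add: divide_right_mono\<close>)
    qed
    moreover have "((\<lambda>s. ?O (-s) / s) \<longlongrightarrow> 0) at_top"
    proof (rule Lim_null_comparison)
      show "((\<lambda>s. 2 * (?D s / s)) \<longlongrightarrow> 0) at_top"
        using tendsto_mult_right_zero[OF rate] .
      show "eventually (\<lambda>s. norm (?O (-s) / s) \<le> 2 * (?D s / s)) at_top"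
        using eventually_gt_at_top[of 0]
      proof eventually_elim
        case (elim s)
        have "\<bar>?O (-s)\<bar> \<le> 2 * ?D s"
          using speeds(1-3)[of s] elim by linarith
        then have "\<bar>?O (-s)\<bar> / s \<le> 2 * ?D s / s"
          using elim by (intro divide_right_mono) auto
        then show ?case
          using elim by simp
      qed
    qed
    ultimately show ?thesis
      using tendsto_at_bot_of_reflected_ratio[of ?T 0] tendsto_at_bot_of_reflected_ratio[of ?O 0] by simp
  qed
  then show "parabolic_petal \<phi> \<Delta> \<Longrightarrow> ((\<lambda>t. ?O t / t) \<longlongrightarrow> 0) at_bot"
    "parabolic_petal \<phi> \<Delta> \<Longrightarrow> ((\<lambda>t. ?T t / t) \<longlongrightarrow> 0) at_bot"
    by blast+
qed

end
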